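(* Let $n\ge1$, $K=\mathrm U_{2n}$, $l,L\in\mathbb Z$, and let $N_1\ge N_2\ge\cdots\ge N_n$ be integers with $N_n\ge|l+L|$. Let $\pi_K\subset C^\infty(K)$ be the space of smooth $f$ with $f(tk)=\prod_{i=1}^n\chi_{N_i+L}(t_{2i-1})\chi_{-N_i+L}(t_{2i})f(k)$ for $t=\mathrm{diag}(t_1,\dots,t_{2n})\in T\cap K$, with $K$ acting by right translation. Then the function $\iota(F_{\vec N,l,L}):k\mapsto F_{\vec N,l,L}(k)$ lies in $\pi_K$, lies in the minimal $K$-type $\tau$ of $\pi_K$ (the irreducible constituent of highest weight $\Lambda=(N_1+L,\dots,N_n+L,-N_n+L,\dots,-N_1+L)$), and satisfies $\iota(F_{\vec N,l,L})\big(k\,\mathrm{diag}(k_1,k_2)\big)=\chi_{-l}(\det k_1)\chi_{l+2L}(\det k_2)\,\iota(F_{\vec N,l,L})(k)$ for all $k\in K$, $k_1,k_2\in\mathrm U_n$.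
   Context: $T\cap K$ is the group of diagonal unitary matrices; $\chi_N(z)=(z/|z|)^N$. For $Z=(z_{a,b})\in M_{2n}(\mathbb C)$: $u_j=(z_{j,1},\dots,z_{j,n})$, $\bar u_j$ its conjugate, $\Phi_{jl}(Z)=\sum_{i=1}^n z_{j,i}\bar z_{l,i}$; $F_k=\sum_s\mathrm{sgn}(s)\prod_{i=1}^k\Phi_{2i-1,s(2i-1)+1}$ over permutations $s$ of $\{1,3,\dots,2k-1\}$; $\Delta_{1,+}(Z)=\det(\text{rows }u_1,u_3,\dots,u_{2n-1})$, $\Delta_{1,-}(Z)=\det(\text{rows }\bar u_2,\bar u_4,\dots,\bar u_{2n})$, $\Delta_{2,+}=\det Z$, $\Delta_{2,-}=\det\bar Z$. Define $F_{\vec N,l,L}=\big(\prod_{i=1}^{n-1}F_i^{N_i-N_{i+1}}\big)F_n^{N_n-|l+L|}D_1D_2$ with $D_1=\Delta_{1,-}^{2(l+L)}$ if $l+L\ge0$, $D_1=\Delta_{1,+}^{-2(l+L)}$ if $l+L\le0$, $D_2=\Delta_{2,+}^{l+2L}$ if $l+2L\ge0$, $D_2=\Delta_{2,-}^{-(l+2L)}$ if $l+2L\le0$. *)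

theory Defs
  imports "HOL-Analysis.Analysis"
begin

coinductive smooth_on :: "'a::real_normed_vector set \<Rightarrow> ('a \<Rightarrow> 'b::real_normed_vector) \<Rightarrow> bool"
  for U where
  "\<lbrakk>\<forall>x\<in>U. f differentiable (at x);
    \<forall>v. smooth_on U (\<lambda>x. frechet_derivative f (at x) v)\<rbrakk> \<Longrightarrow> smooth_on U f"

section \<open>Matrices of size 2n, rows/columns enumerated by idx : {1..2n} -> 'm\<close>

definition ent :: "(nat \<Rightarrow> 'm::finite) \<Rightarrow> complex^'m^'m \<Rightarrow> nat \<Rightarrow> nat \<Rightarrow> complex" where
  "ent idx Z a b = Z $ idx a $ idx b"

definition ctrans :: "complex^'m^'m \<Rightarrow> complex^'m^'m" where
  "ctrans A = (\<chi> i j. cnj (A $ j $ i))"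

definition UK :: "(complex^'m::finite^'m) set" where
  "UK = {A. A ** ctrans A = mat 1}"

definition TK :: "(complex^'m::finite^'m) set" where
  "TK = {D. (\<forall>i j. i \<noteq> j \<longrightarrow> D $ i $ j = 0) \<and> (\<forall>i. cmod (D $ i $ i) = 1)}"

definition chi :: "int \<Rightarrow> complex \<Rightarrow> complex" where
  "chi N z = (z / complex_of_real (cmod z)) powi N"

definition detn :: "nat \<Rightarrow> (nat \<Rightarrow> nat \<Rightarrow> complex) \<Rightarrow> complex" where
  "detn k M = (\<Sum>p | p permutes {1..k}. of_int (sign p) * (\<Prod>i=1..k. M i (p i)))"

definition Unit_n :: "nat \<Rightarrow> (nat \<Rightarrow> nat \<Rightarrow> complex) set" where
  "Unit_n n = {M. \<forall>i\<in>{1..n}. \<forall>j\<in>{1..n}.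
              (\<Sum>c=1..n. M i c * cnj (M j c)) = (if i = j then 1 else 0)}"

definition blockdiag :: "nat \<Rightarrow> (nat \<Rightarrow> 'm::finite) \<Rightarrow> (nat \<Rightarrow> nat \<Rightarrow> complex)
    \<Rightarrow> (nat \<Rightarrow> nat \<Rightarrow> complex) \<Rightarrow> complex^'m^'m" where
  "blockdiag n idx k1 k2 = (\<chi> i j.
     let a = inv_into {1..2*n} idx i; b = inv_into {1..2*n} idx j in
     if a \<le> n \<and> b \<le> n then k1 a b
     else if n < a \<and> n < b then k2 (a - n) (b - n) else 0)"

definition Phi :: "nat \<Rightarrow> (nat \<Rightarrow> 'm::finite) \<Rightarrow> complex^'m^'m \<Rightarrow> nat \<Rightarrow> nat \<Rightarrow> complex" where
  "Phi n idx Z j l = (\<Sum>i=1..n. ent idx Z j i * cnj (ent idx Z l i))"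

definition Fk :: "nat \<Rightarrow> (nat \<Rightarrow> 'm::finite) \<Rightarrow> nat \<Rightarrow> complex^'m^'m \<Rightarrow> complex" where
  "Fk n idx k Z = (\<Sum>s | s permutes {2*i - 1 | i. 1 \<le> i \<and> i \<le> k}.
      of_int (sign s) * (\<Prod>i=1..k. Phi n idx Z (2*i - 1) (s (2*i - 1) + 1)))"

definition Delta1p :: "nat \<Rightarrow> (nat \<Rightarrow> 'm::finite) \<Rightarrow> complex^'m^'m \<Rightarrow> complex" where
  "Delta1p n idx Z = detn n (\<lambda>i c. ent idx Z (2*i - 1) c)"

definition Delta1m :: "nat \<Rightarrow> (nat \<Rightarrow> 'm::finite) \<Rightarrow> complex^'m^'m \<Rightarrow> complex" where
  "Delta1m n idx Z = detn n (\<lambda>i c. cnj (ent idx Z (2*i) c))"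

definition Delta2p :: "nat \<Rightarrow> (nat \<Rightarrow> 'm::finite) \<Rightarrow> complex^'m^'m \<Rightarrow> complex" where
  "Delta2p n idx Z = detn (2*n) (\<lambda>a b. ent idx Z a b)"

definition Delta2m :: "nat \<Rightarrow> (nat \<Rightarrow> 'm::finite) \<Rightarrow> complex^'m^'m \<Rightarrow> complex" where
  "Delta2m n idx Z = detn (2*n) (\<lambda>a b. cnj (ent idx Z a b))"

definition FNlL :: "nat \<Rightarrow> (nat \<Rightarrow> 'm::finite) \<Rightarrow> (nat \<Rightarrow> int) \<Rightarrow> int \<Rightarrow> int
    \<Rightarrow> complex^'m^'m \<Rightarrow> complex" where
  "FNlL n idx N l L Z =
     (\<Prod>i=1..n-1. Fk n idx i Z ^ nat (N i - N (i+1)))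
     * Fk n idx n Z ^ nat (N n - \<bar>l + L\<bar>)
     * (if l + L \<ge> 0 then Delta1m n idx Z ^ nat (2*(l+L)) else Delta1p n idx Z ^ nat (-2*(l+L)))
     * (if l + 2*L \<ge> 0 then Delta2p n idx Z ^ nat (l+2*L) else Delta2m n idx Z ^ nat (-(l+2*L)))"

text \<open>Functions on K are modelled as functions on all matrices vanishing off K.\<close>
definition iota :: "(complex^'m::finite^'m \<Rightarrow> complex) \<Rightarrow> complex^'m^'m \<Rightarrow> complex" where
  "iota F = (\<lambda>k. if k \<in> UK then F k else 0)"

definition smoothK :: "(complex^'m::finite^'m \<Rightarrow> complex) \<Rightarrow> bool" where
  "smoothK f \<longleftrightarrow> (\<exists>U g. open U \<and> UK \<subseteq> U \<and> smooth_on U g \<and> (\<forall>k\<in>UK. f k = g k))"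

definition piK :: "nat \<Rightarrow> (nat \<Rightarrow> 'm::finite) \<Rightarrow> (nat \<Rightarrow> int) \<Rightarrow> int
    \<Rightarrow> (complex^'m^'m \<Rightarrow> complex) set" where
  "piK n idx N L = {f. smoothK f \<and> (\<forall>k. k \<notin> UK \<longrightarrow> f k = 0) \<and>
     (\<forall>t\<in>TK. \<forall>k\<in>UK. f (t ** k) =
        (\<Prod>i=1..n. chi (N i + L) (ent idx t (2*i-1) (2*i-1)) * chi (- N i + L) (ent idx t (2*i) (2*i)))
        * f k)}"

definition Rtr :: "complex^'m::finite^'m \<Rightarrow> (complex^'m^'m \<Rightarrow> complex) \<Rightarrow> complex^'m^'m \<Rightarrow> complex" where
  "Rtr k f = (\<lambda>x. if x \<in> UK then f (x ** k) else 0)"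

definition csubspace :: "('a \<Rightarrow> complex) set \<Rightarrow> bool" where
  "csubspace W \<longleftrightarrow> (\<lambda>x. 0) \<in> W \<and> (\<forall>f\<in>W. \<forall>g\<in>W. (\<lambda>x. f x + g x) \<in> W)
      \<and> (\<forall>c. \<forall>f\<in>W. (\<lambda>x. c * f x) \<in> W)"

definition cspan :: "('a \<Rightarrow> complex) set \<Rightarrow> ('a \<Rightarrow> complex) set" where
  "cspan B = {f. \<exists>c. f = (\<lambda>x. \<Sum>b\<in>B. c b * b x)}"

definition Kinvariant :: "(complex^'m::finite^'m \<Rightarrow> complex) set \<Rightarrow> bool" where
  "Kinvariant W \<longleftrightarrow> (\<forall>k\<in>UK. \<forall>f\<in>W. Rtr k f \<in> W)"

definition irred_Ksubrep :: "(complex^'m::finite^'m \<Rightarrow> complex) set \<Rightarrow> bool" where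
  "irred_Ksubrep W \<longleftrightarrow> csubspace W \<and> Kinvariant W
     \<and> (\<exists>B. finite B \<and> B \<subseteq> W \<and> W \<subseteq> cspan B)
     \<and> (\<exists>f\<in>W. f \<noteq> (\<lambda>x. 0))
     \<and> (\<forall>V. csubspace V \<and> Kinvariant V \<and> V \<subseteq> W \<longrightarrow> V = {\<lambda>x. 0} \<or> V = W)"

definition is_weight :: "nat \<Rightarrow> (nat \<Rightarrow> 'm::finite) \<Rightarrow> (complex^'m^'m \<Rightarrow> complex) set
    \<Rightarrow> (nat \<Rightarrow> int) \<Rightarrow> bool" where
  "is_weight n idx W mu \<longleftrightarrow> (\<exists>f\<in>W. f \<noteq> (\<lambda>x. 0) \<and>
     (\<forall>t\<in>TK. Rtr t f = (\<lambda>x. (\<Prod>a=1..2*n. chi (mu a) (ent idx t a a)) * f x)))"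

text \<open>dominance order: Lam - mu is a nonnegative integer combination of the
  positive roots e_a - e_(a+1)\<close>
definition dominated :: "nat \<Rightarrow> (nat \<Rightarrow> int) \<Rightarrow> (nat \<Rightarrow> int) \<Rightarrow> bool" where
  "dominated m mu Lam \<longleftrightarrow> (\<forall>j\<in>{1..m}. (\<Sum>a=1..j. mu a) \<le> (\<Sum>a=1..j. Lam a))
      \<and> (\<Sum>a=1..m. mu a) = (\<Sum>a=1..m. Lam a)"

definition constituent_hw :: "nat \<Rightarrow> (nat \<Rightarrow> 'm::finite) \<Rightarrow> (nat \<Rightarrow> int) \<Rightarrow> int
    \<Rightarrow> (nat \<Rightarrow> int) \<Rightarrow> (complex^'m^'m \<Rightarrow> complex) set \<Rightarrow> bool" where
  "constituent_hw n idx N L Lam W \<longleftrightarrow> W \<subseteq> piK n idx N L \<and> irred_Ksubrep W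
     \<and> is_weight n idx W Lam
     \<and> (\<forall>mu. is_weight n idx W mu \<longrightarrow> dominated (2*n) mu Lam)"

definition LambdaW :: "nat \<Rightarrow> (nat \<Rightarrow> int) \<Rightarrow> int \<Rightarrow> nat \<Rightarrow> int" where
  "LambdaW n N L a = (if a \<le> n then N a + L else - N (2*n + 1 - a) + L)"

end

(* Order the rows as 1, 3, \<dots>, 2n-1, 2n, \<dots>, 4, 2. Expanding the F_k by Cauchy-Binet shows that the
   function of the theorem is a linear combination of products of minors on initial rows, conjugated
   minors on final rows, and powers of the determinant. Let f be the product of the corresponding
   principal minors. Cauchy-Binet also gives f(x y') = sum_i m_i(x) conj(m_i(y)), where y' is the
   adjoint of y and the m_i run over all such products of minors with varying columns. Positivity of
   this kernel shows that the span W of the m_i on K is the span of the right translates of f. Each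
   m_i is a right weight vector whose weight is dominated by that of f, and only multiples of f attain
   the latter. Hence averaging over a one-parameter torus maps g in W to g(1) f, so that a nonzero
   invariant subspace of W, which contains some g with g(1) nonzero, contains f and is all of W. *)
theory Submission
  imports Defs "HOL-Library.Function_Algebras" "HOL-Combinatorics.Permutations"
begin

section \<open>Determinants over finite index sets\<close>

text \<open>Irreducibility is obtained without an invariant integral and without the theorem of the
  highest weight. The row order sorts the left character: the exponents N_i + L of the odd rows and
  -N_i + L of the even rows, read along it, form the decreasing sequence Lambda. So f has the same
  extremal weight on both sides; it is the diagonal matrix coefficient of an extremal vector of the
  minimal K-type, and f(x y') is its reproducing kernel. The obstacle is that products of minors are
  in general linearly dependent, so neither irreducibility nor the list of weights can be read off
  from a basis. Averages over the torus act on functions rather than on coefficients and are not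
  affected by this; finite sums over roots of unity suffice for them. One cocharacter singles out
  the extremal weight because its exponents 2n, ..., 1 are strictly decreasing. The weights of the
  K-type refer to the given enumeration while f is extremal for the row order; a permutation matrix
  passes from one to the other. Minors of varying size are the reason for determinants over finite
  index sets.\<close>

definition det_on :: "'i set \<Rightarrow> ('i \<Rightarrow> 'i \<Rightarrow> complex) \<Rightarrow> complex" where
  "det_on S M = (\<Sum>p | p permutes S. of_int (sign p) * (\<Prod>i\<in>S. M i (p i)))"

lemma detn_eq_det_on: "detn k M = det_on {1..k} M"
  by (simp add: detn_def det_on_def)

lemma det_on_cong:
  assumes "\<And>i j. i \<in> S \<Longrightarrow> j \<in> S \<Longrightarrow> M i j = M' i j"
  shows "det_on S M = det_on S M'"
  unfolding det_on_def
  by (intro sum.cong refl arg_cong2[where f = "(*)"] prod.cong)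
     (auto simp: assms permutes_in_image)

text \<open>Conjugation by \<open>h\<close> carries the permutations of \<open>S\<close> to those of
  \<open>T\<close> and preserves signs, so the two Leibniz sums agree term by term.\<close>

lemma det_on_reindex:
  assumes h: "bij_betw h S T" and fin: "finite S"
  shows "det_on T M = det_on S (\<lambda>i j. M (h i) (h j))"
proof -
  have inj: "inj_on h S" and T: "T = h ` S"
    using h by (auto simp: bij_betw_def)
  have bij: "bij_betw (map_permutation S h) {p. p permutes S} {p. p permutes T}"
  proof (rule bij_betw_byWitness[where f' = "map_permutation T (inv_into S h)"])
    show "\<forall>p\<in>{p. p permutes S}. map_permutation T (inv_into S h) (map_permutation S h p) = p"
      using map_permutation_compose_inv[OF h, of _ "inv_into S h"] inj by auto
    show "\<forall>p\<in>{p. p permutes T}. map_permutation S h (map_permutation T (inv_into S h) p) = p"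
      using map_permutation_compose_inv[OF bij_betw_inv_into[OF h], of _ h] inj T
      by (auto simp: f_inv_into_f)
    show "map_permutation S h ` {p. p permutes S} \<subseteq> {p. p permutes T}"
      using map_permutation_permutes[OF h] by auto
    show "map_permutation T (inv_into S h) ` {p. p permutes T} \<subseteq> {p. p permutes S}"
      using map_permutation_permutes[OF bij_betw_inv_into[OF h]] by auto
  qed
  have "det_on T M = (\<Sum>p | p permutes S. of_int (sign (map_permutation S h p))
      * (\<Prod>i\<in>T. M i (map_permutation S h p i)))"
    unfolding det_on_def by (rule sum.reindex_bij_betw[OF bij, symmetric])
  also have "\<dots> = det_on S (\<lambda>i j. M (h i) (h j))"
    unfolding det_on_def
  proof (intro sum.cong refl arg_cong2[where f = "(*)"])
    fix p assume "p \<in> {p. p permutes S}"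
    then have p: "p permutes S" by simp
    show "of_int (sign (map_permutation S h p)) = (of_int (sign p) :: complex)"
      using sign_map_permutation[OF inj p fin] by simp
    have "(\<Prod>i\<in>T. M i (map_permutation S h p i)) = (\<Prod>i\<in>S. M (h i) (map_permutation S h p (h i)))"
      unfolding T using inj by (simp add: prod.reindex)
    then show "(\<Prod>i\<in>T. M i (map_permutation S h p i)) = (\<Prod>i\<in>S. M (h i) (h (p i)))"
      using map_permutation_apply[OF inj] by simp
  qed
  finally show ?thesis .
qed

lemma det_on_transpose:
  assumes "finite S"
  shows "det_on S (\<lambda>i j. M j i) = det_on S M"
proof -
  have "det_on S (\<lambda>i j. M j i)
      = (\<Sum>p | p permutes S. of_int (sign (inv p)) * (\<Prod>i\<in>S. M (inv p i) i))"
    unfolding det_on_def by (rule sum_permutations_inverse)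
  also have "\<dots> = det_on S M"
    unfolding det_on_def
  proof (intro sum.cong refl)
    fix p assume "p \<in> {p. p permutes S}"
    then have p: "p permutes S" by simp
    have "(\<Prod>i\<in>S. M (inv p i) i) = (\<Prod>i\<in>S. M (inv p (p i)) (p i))"
      using prod.permute[OF p, of "\<lambda>i. M (inv p i) i"] by (simp add: o_def)
    also have "\<dots> = (\<Prod>i\<in>S. M i (p i))"
      using permutes_inverses(2)[OF p] by simp
    finally show "of_int (sign (inv p)) * (\<Prod>i\<in>S. M (inv p i) i)
        = of_int (sign p) * (\<Prod>i\<in>S. M i (p i))"
      using sign_inverse permutation_permutes p assms by metis
  qed
  finally show ?thesis .
qed

lemma det_on_permute_rows:
  assumes p: "p permutes S" and fin: "finite S"
  shows "det_on S (\<lambda>i j. M (p i) j) = of_int (sign p) * det_on S M"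
proof -
  have "of_int (sign p) * det_on S M
      = (\<Sum>q | q permutes S. of_int (sign p) * (of_int (sign (q \<circ> p)) * (\<Prod>i\<in>S. M i ((q \<circ> inv p) i))))"
  proof -
    have "det_on S M = (\<Sum>q | q permutes S. of_int (sign (q \<circ> inv p)) * (\<Prod>i\<in>S. M i ((q \<circ> inv p) i)))"
      unfolding det_on_def by (rule sum_permutations_compose_right[OF permutes_inv[OF p]])
    also have "\<dots> = (\<Sum>q | q permutes S. of_int (sign (q \<circ> p)) * (\<Prod>i\<in>S. M i ((q \<circ> inv p) i)))"
    proof (intro sum.cong refl)
      fix q assume "q \<in> {q. q permutes S}"
      then have "permutation q" "permutation p" "permutation (inv p)"
        using p fin by (auto simp: permutation_permutes intro: permutes_inv)
      then show "of_int (sign (q \<circ> inv p)) * (\<Prod>i\<in>S. M i ((q \<circ> inv p) i)) =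
         of_int (sign (q \<circ> p)) * (\<Prod>i\<in>S. M i ((q \<circ> inv p) i))"
        by (simp add: sign_compose sign_inverse)
    qed
    finally show ?thesis by (simp add: sum_distrib_left)
  qed
  also have "\<dots> = det_on S (\<lambda>i j. M (p i) j)"
    unfolding det_on_def
  proof (intro sum.cong refl)
    fix q assume "q \<in> {q. q permutes S}"
    then have perm: "permutation q" "permutation p"
      using p fin by (auto simp: permutation_permutes)
    have "(\<Prod>i\<in>S. M i ((q \<circ> inv p) i)) = (\<Prod>i\<in>S. M (p i) (q i))"
      using prod.permute[OF p, of "\<lambda>i. M i ((q \<circ> inv p) i)"] permutes_inverses(2)[OF p]
      by (simp add: o_def)
    moreover have "of_int (sign p) * of_int (sign (q \<circ> p)) = (of_int (sign q) :: complex)"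
      using perm by (simp only: sign_compose) (simp add: sign_def)
    ultimately show "of_int (sign p) * (of_int (sign (q \<circ> p)) * (\<Prod>i\<in>S. M i ((q \<circ> inv p) i)))
        = of_int (sign q) * (\<Prod>i\<in>S. M (p i) (q i))"
      by (metis mult.assoc)
  qed
  finally show ?thesis by simp
qed

lemma det_on_permute_columns:
  assumes "p permutes S" and "finite S"
  shows "det_on S (\<lambda>i j. M i (p j)) = of_int (sign p) * det_on S M"
  using det_on_permute_rows[OF assms, of "\<lambda>i j. M j i"]
    det_on_transpose[OF assms(2), of "\<lambda>i j. M i (p j)"] det_on_transpose[OF assms(2), of M]
  by simp

lemma det_on_identical_rows:
  assumes "finite S" "i \<in> S" "j \<in> S" "i \<noteq> j" and eq: "\<And>c. M i c = M j c"
  shows "det_on S M = 0"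
proof -
  let ?p = "Transposition.transpose i j"
  have "(\<lambda>a. M (?p a)) = M"
    by (auto simp: Transposition.transpose_def fun_eq_iff eq)
  moreover have "?p permutes S"
    using assms by (intro permutes_swap_id)
  ultimately have "det_on S M = of_int (sign ?p) * det_on S M"
    using det_on_permute_rows[of ?p S M] assms(1) by simp
  then show ?thesis
    using assms(4) by (simp add: sign_swap_id)
qed

lemma det_on_noninjective_rows:
  assumes "finite S" "\<not> inj_on g S"
  shows "det_on S (\<lambda>i j. M (g i) j) = 0"
proof -
  obtain i j where "i \<in> S" "j \<in> S" "i \<noteq> j" "g i = g j"
    using assms(2) by (auto simp: inj_on_def)
  then show ?thesis
    using assms(1) by (intro det_on_identical_rows[of S i j]) auto
qed

lemma det_on_zero_row:
  assumes "finite S" "i \<in> S" "\<And>j. j \<in> S \<Longrightarrow> M i j = 0"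
  shows "det_on S M = 0"
  unfolding det_on_def
proof (intro sum.neutral ballI)
  fix p assume "p \<in> {p. p permutes S}"
  then have "M i (p i) = 0"
    using assms by (simp add: permutes_in_image)
  then show "of_int (sign p) * (\<Prod>i\<in>S. M i (p i)) = 0"
    using assms by (auto simp: prod_zero_iff)
qed

lemma det_on_scale_columns:
  assumes "finite S"
  shows "det_on S (\<lambda>i j. M i j * c j) = det_on S M * (\<Prod>j\<in>S. c j)"
proof -
  have "of_int (sign p) * (\<Prod>i\<in>S. M i (p i) * c (p i))
      = of_int (sign p) * (\<Prod>i\<in>S. M i (p i)) * (\<Prod>j\<in>S. c j)" if "p permutes S" for p
    using prod.permute[OF that, of c] by (simp add: prod.distrib o_def)
  then show ?thesis
    unfolding det_on_def sum_distrib_right by (intro sum.cong) auto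
qed

lemma det_on_scale_rows:
  "det_on S (\<lambda>i j. c i * M i j) = (\<Prod>i\<in>S. c i) * det_on S M"
  by (simp add: det_on_def prod.distrib sum_distrib_left mult_ac)

lemma det_on_cnj: "cnj (det_on S M) = det_on S (\<lambda>i j. cnj (M i j))"
  by (simp add: det_on_def)

text \<open>Only the permutations fixing the complement of T contribute to the left-hand side.\<close>
lemma det_on_restrict:
  assumes fin: "finite S" and sub: "T \<subseteq> S"
    and one: "\<And>i. i \<in> S - T \<Longrightarrow> M i i = 1"
    and zero: "\<And>i j. i \<in> S - T \<Longrightarrow> j \<in> S \<Longrightarrow> j \<noteq> i \<Longrightarrow> M i j = 0"
  shows "det_on S M = det_on T M"
proof -
  have "det_on T M = (\<Sum>p | p permutes T. of_int (sign p) * (\<Prod>i\<in>S. M i (p i)))"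
    unfolding det_on_def
  proof (intro sum.cong refl arg_cong2[where f = "(*)"])
    fix p assume "p \<in> {p. p permutes T}"
    then have "\<forall>i\<in>S - T. M i (p i) = 1"
      using one by (auto simp: permutes_not_in)
    then show "(\<Prod>i\<in>T. M i (p i)) = (\<Prod>i\<in>S. M i (p i))"
      using fin sub by (intro prod.mono_neutral_left) auto
  qed
  also have "\<dots> = det_on S M"
    unfolding det_on_def
  proof (rule sum.mono_neutral_left)
    show "finite {p. p permutes S}"
      using fin by (rule finite_permutations)
    show "{p. p permutes T} \<subseteq> {p. p permutes S}"
      using sub permutes_subset by auto
    show "\<forall>p\<in>{p. p permutes S} - {p. p permutes T}. of_int (sign p) * (\<Prod>i\<in>S. M i (p i)) = 0"
    proof
      fix p assume p: "p \<in> {p. p permutes S} - {p. p permutes T}"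
      then obtain i where "i \<in> S - T" "p i \<noteq> i"
        using permutes_superset[of p S T] by auto
      then have "M i (p i) = 0"
        using p zero[of i "p i"] by (auto simp: permutes_in_image)
      then show "of_int (sign p) * (\<Prod>i\<in>S. M i (p i)) = 0"
        using fin \<open>i \<in> S - T\<close> by (auto simp: prod_zero_iff)
    qed
  qed
  finally show ?thesis by simp
qed

lemma det_on_identity: "finite S \<Longrightarrow> det_on S (\<lambda>i j. if i = j then 1 else 0) = 1"
  using det_on_restrict[of S "{}" "\<lambda>i j. if i = j then 1 else 0"]
  by (simp add: det_on_def)

section \<open>Determinants of matrix products and the Cauchy-Binet formula\<close>

lemma det_on_mult_expand:
  assumes "finite S" "finite C"
  shows "det_on S (\<lambda>i j. \<Sum>c\<in>C. P i c * Q c j)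
    = (\<Sum>g\<in>S \<rightarrow>\<^sub>E C. (\<Prod>i\<in>S. P i (g i)) * det_on S (\<lambda>i j. Q (g i) j))"
proof -
  \<comment> \<open>Distributing the product of the row sums: \<open>g\<close> records the summand
    chosen in each row.\<close>
  have "det_on S (\<lambda>i j. \<Sum>c\<in>C. P i c * Q c j)
      = (\<Sum>p | p permutes S. \<Sum>g\<in>S \<rightarrow>\<^sub>E C. of_int (sign p) * (\<Prod>i\<in>S. P i (g i) * Q (g i) (p i)))"
    unfolding det_on_def using assms by (simp add: prod_sum_PiE sum_distrib_left)
  also have "\<dots> = (\<Sum>g\<in>S \<rightarrow>\<^sub>E C. \<Sum>p | p permutes S.
      of_int (sign p) * (\<Prod>i\<in>S. P i (g i) * Q (g i) (p i)))"
    by (rule sum.swap)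
  also have "\<dots> = (\<Sum>g\<in>S \<rightarrow>\<^sub>E C. (\<Prod>i\<in>S. P i (g i)) * det_on S (\<lambda>i j. Q (g i) j))"
    unfolding det_on_def by (simp add: prod.distrib sum_distrib_left mult_ac)
  finally show ?thesis .
qed

text \<open>Ordered choices of columns, which spare fixing an enumeration of every column set.
  Extensionality makes each choice a single function.\<close>

definition inj_funs :: "'i set \<Rightarrow> 'c set \<Rightarrow> ('i \<Rightarrow> 'c) set" where
  "inj_funs S C = {g \<in> S \<rightarrow>\<^sub>E C. inj_on g S}"

lemma finite_inj_funs: "finite S \<Longrightarrow> finite C \<Longrightarrow> finite (inj_funs S C)"
  by (simp add: inj_funs_def finite_PiE)

lemma bij_inj_funs_permute:
  assumes p: "p permutes S"
  shows "bij_betw (\<lambda>g. g \<circ> p) (inj_funs S C) (inj_funs S C)"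
proof -
  have closed: "g \<circ> q \<in> inj_funs S C" if q: "q permutes S" and g: "g \<in> inj_funs S C" for q g
  proof -
    have "inj_on (g \<circ> q) S"
      using g permutes_inj_on[OF q] permutes_image[OF q] by (auto simp: inj_funs_def intro!: comp_inj_on)
    moreover have "g \<circ> q \<in> S \<rightarrow>\<^sub>E C"
      using g q by (auto simp: inj_funs_def PiE_iff extensional_def permutes_in_image permutes_not_in)
    ultimately show ?thesis by (simp add: inj_funs_def)
  qed
  show ?thesis
  proof (rule bij_betw_byWitness[where f' = "\<lambda>g. g \<circ> inv p"])
    show "(\<lambda>g. g \<circ> p) ` inj_funs S C \<subseteq> inj_funs S C"
      using closed[OF p] by auto
    show "(\<lambda>g. g \<circ> inv p) ` inj_funs S C \<subseteq> inj_funs S C"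
      using closed[OF permutes_inv[OF p]] by auto
  qed (auto simp: o_assoc[symmetric] permutes_inv_o[OF p])
qed

text \<open>Every subset of columns is counted once for each of its orderings, whence the factorial.\<close>
lemma Cauchy_Binet:
  assumes fin: "finite S" "finite C"
  shows "fact (card S) * det_on S (\<lambda>i j. \<Sum>c\<in>C. P i c * Q c j)
    = (\<Sum>g\<in>inj_funs S C. det_on S (\<lambda>i j. P i (g j)) * det_on S (\<lambda>i j. Q (g i) j))"
proof -
  let ?D = "\<lambda>g. det_on S (\<lambda>i j. Q (g i) j)"
  let ?X = "det_on S (\<lambda>i j. \<Sum>c\<in>C. P i c * Q c j)"
  have X: "?X = (\<Sum>g\<in>inj_funs S C. (\<Prod>i\<in>S. P i (g i)) * ?D g)"
    unfolding det_on_mult_expand[OF fin]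
    by (rule sum.mono_neutral_right) (use fin det_on_noninjective_rows[OF fin(1)] in \<open>auto simp: inj_funs_def finite_PiE\<close>)
  \<comment> \<open>Replacing \<open>g\<close> by \<open>g \<circ> p\<close> costs the sign of
    \<open>p\<close> in the determinant of \<open>Q\<close> and permutes the factors of
    \<open>P\<close>; summing over all \<open>p\<close> then completes the Leibniz sum of the minor
    of \<open>P\<close>.\<close>
  have Xp: "?X = (\<Sum>g\<in>inj_funs S C. of_int (sign p) * (\<Prod>i\<in>S. P i (g (p i))) * ?D g)"
    if p: "p permutes S" for p
  proof -
    have "?X = (\<Sum>g\<in>inj_funs S C. (\<Prod>i\<in>S. P i ((g \<circ> p) i)) * ?D (g \<circ> p))"
      unfolding X by (rule sum.reindex_bij_betw[OF bij_inj_funs_permute[OF p], symmetric])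
    also have "\<dots> = (\<Sum>g\<in>inj_funs S C. of_int (sign p) * (\<Prod>i\<in>S. P i (g (p i))) * ?D g)"
      using det_on_permute_rows[OF p fin(1), of "\<lambda>i j. Q (_ i) j"] by (intro sum.cong) auto
    finally show ?thesis .
  qed
  have "fact (card S) * ?X = (\<Sum>p | p permutes S. ?X)"
    using card_permutations[OF refl fin(1)] by simp
  also have "\<dots> = (\<Sum>p | p permutes S. \<Sum>g\<in>inj_funs S C.
      of_int (sign p) * (\<Prod>i\<in>S. P i (g (p i))) * ?D g)"
    using Xp by (intro sum.cong) auto
  also have "\<dots> = (\<Sum>g\<in>inj_funs S C. det_on S (\<lambda>i j. P i (g j)) * ?D g)"
    by (subst sum.swap) (simp add: det_on_def sum_distrib_right)
  finally show ?thesis .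
qed

text \<open>An injective self-map of a finite set is a bijection. Restriction reconciles two
  conventions outside \<open>S\<close>: permutations are the identity there, members of
  \<open>inj_funs\<close> are undefined.\<close>

lemma bij_permutes_inj_funs:
  assumes fin: "finite S"
  shows "bij_betw (\<lambda>p. restrict p S) {p. p permutes S} (inj_funs S S)"
  unfolding bij_betw_def
proof (intro conjI subset_antisym subsetI)
  show "inj_on (\<lambda>p. restrict p S) {p. p permutes S}"
  proof (rule inj_onI)
    fix p q assume pq: "p \<in> {p. p permutes S}" "q \<in> {p. p permutes S}" "restrict p S = restrict q S"
    show "p = q"
    proof
      fix i show "p i = q i"
        using pq(1,2) fun_cong[OF pq(3), of i] unfolding restrict_def
        by (cases "i \<in> S") (simp_all add: permutes_not_in)
    qed
  qed
next
  fix g assume "g \<in> (\<lambda>p. restrict p S) ` {p. p permutes S}"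
  then obtain p where "p permutes S" "g = restrict p S"
    by auto
  then show "g \<in> inj_funs S S"
    using permutes_inj_on[of p S S] by (auto simp: inj_funs_def permutes_in_image inj_on_restrict_eq)
next
  fix g assume g: "g \<in> inj_funs S S"
  let ?p = "\<lambda>i. if i \<in> S then g i else i"
  have "inj_on g S" "g ` S \<subseteq> S"
    using g by (auto simp: inj_funs_def)
  then have "bij_betw g S S"
    using fin by (simp add: bij_betw_def endo_inj_surj)
  then have "bij_betw ?p S S"
    by (simp cong: bij_betw_cong)
  then have "?p permutes S"
    by (rule bij_imp_permutes) auto
  moreover have "g = restrict ?p S"
    using g by (auto simp: inj_funs_def fun_eq_iff PiE_iff extensional_def)
  ultimately show "g \<in> (\<lambda>p. restrict p S) ` {p. p permutes S}"
    by blast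
qed

text \<open>In the square case the choice functions that survive are permutations, and each
  contributes a signed copy of \<open>det_on S Q\<close>.\<close>

lemma det_on_mult:
  assumes fin: "finite S"
  shows "det_on S (\<lambda>i j. \<Sum>c\<in>S. P i c * Q c j) = det_on S P * det_on S Q"
proof -
  let ?f = "\<lambda>g. (\<Prod>i\<in>S. P i (g i)) * det_on S (\<lambda>i j. Q (g i) j)"
  have "det_on S (\<lambda>i j. \<Sum>c\<in>S. P i c * Q c j) = (\<Sum>g\<in>inj_funs S S. ?f g)"
    unfolding det_on_mult_expand[OF fin fin]
    by (rule sum.mono_neutral_right)
       (use fin det_on_noninjective_rows[OF fin] in \<open>auto simp: inj_funs_def finite_PiE\<close>)
  also have "\<dots> = (\<Sum>p | p permutes S. ?f (restrict p S))"
    by (rule sum.reindex_bij_betw[OF bij_permutes_inj_funs[OF fin], symmetric])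
  also have "\<dots> = (\<Sum>p | p permutes S. of_int (sign p) * (\<Prod>i\<in>S. P i (p i)) * det_on S Q)"
  proof (intro sum.cong refl)
    fix p assume "p \<in> {p. p permutes S}"
    then have p: "p permutes S" by simp
    have "det_on S (\<lambda>i j. Q (restrict p S i) j) = det_on S (\<lambda>i j. Q (p i) j)"
      by (rule det_on_cong) simp
    then show "?f (restrict p S) = of_int (sign p) * (\<Prod>i\<in>S. P i (p i)) * det_on S Q"
      using det_on_permute_rows[OF p fin, of Q] by simp
  qed
  also have "\<dots> = det_on S P * det_on S Q"
    by (simp add: det_on_def[of S P] sum_distrib_right)
  finally show ?thesis .
qed

section \<open>Polynomial functions\<close>

inductive poly_fun :: "(complex^'m::finite^'m \<Rightarrow> complex) \<Rightarrow> bool" where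
  const: "poly_fun (\<lambda>x. c)"
| entry: "poly_fun (\<lambda>x. x $ i $ j)"
| cnj_entry: "poly_fun (\<lambda>x. cnj (x $ i $ j))"
| add: "poly_fun f \<Longrightarrow> poly_fun g \<Longrightarrow> poly_fun (\<lambda>x. f x + g x)"
| mult: "poly_fun f \<Longrightarrow> poly_fun g \<Longrightarrow> poly_fun (\<lambda>x. f x * g x)"

text \<open>By the sum and product rules, differentiation in a fixed direction stays inside the
  class. This closure makes \<open>poly_fun\<close> an invariant for the coinductive notion of
  smoothness.\<close>

lemma poly_fun_has_derivative:
  assumes "poly_fun f"
  shows "\<exists>f'. (\<forall>x. (f has_derivative f' x) (at x)) \<and> (\<forall>v. poly_fun (\<lambda>x. f' x v))"
  using assms
proof induction
  case (const c)
  show ?case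
    by (rule exI[of _ "\<lambda>x v. 0"]) (auto intro: poly_fun.const)
next
  case (entry i j)
  have "bounded_linear (\<lambda>x::complex^'a^'a. x $ i $ j)"
    by (rule bounded_linear_compose[OF bounded_linear_vec_nth bounded_linear_vec_nth])
  then show ?case
    by (intro exI[of _ "\<lambda>x v. v $ i $ j"])
       (auto intro: poly_fun.const bounded_linear_imp_has_derivative)
next
  case (cnj_entry i j)
  have "bounded_linear (\<lambda>x::complex^'a^'a. cnj (x $ i $ j))"
    by (rule bounded_linear_compose[OF bounded_linear_cnj
          bounded_linear_compose[OF bounded_linear_vec_nth bounded_linear_vec_nth]])
  then show ?case
    by (intro exI[of _ "\<lambda>x v. cnj (v $ i $ j)"])
       (auto intro: poly_fun.const bounded_linear_imp_has_derivative)
next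
  case (add f g)
  then obtain f' g' where
    f: "\<And>x. (f has_derivative f' x) (at x)" "\<And>v. poly_fun (\<lambda>x. f' x v)" and
    g: "\<And>x. (g has_derivative g' x) (at x)" "\<And>v. poly_fun (\<lambda>x. g' x v)"
    by metis
  show ?case
    by (rule exI[of _ "\<lambda>x v. f' x v + g' x v"])
       (auto intro!: has_derivative_add f g poly_fun.add)
next
  case (mult f g)
  then obtain f' g' where
    f: "\<And>x. (f has_derivative f' x) (at x)" "\<And>v. poly_fun (\<lambda>x. f' x v)" and
    g: "\<And>x. (g has_derivative g' x) (at x)" "\<And>v. poly_fun (\<lambda>x. g' x v)"
    by metis
  show ?case
    by (rule exI[of _ "\<lambda>x v. f x * g' x v + f' x v * g x"])
       (auto intro!: has_derivative_mult f g poly_fun.add poly_fun.mult mult.hyps)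
qed

lemma poly_fun_smooth:
  assumes "poly_fun f"
  shows "smooth_on UNIV f"
  using assms
proof (coinduction arbitrary: f)
  case smooth_on
  then obtain f' where f': "\<And>x. (f has_derivative f' x) (at x)" "\<And>v. poly_fun (\<lambda>x. f' x v)"
    using poly_fun_has_derivative by blast
  have "frechet_derivative f (at x) = f' x" for x
    using frechet_derivative_at[OF f'(1)] by simp
  then show ?case
    using f' by (auto simp: differentiable_def)
qed

lemma poly_fun_sum: "(\<And>i. i \<in> S \<Longrightarrow> poly_fun (f i)) \<Longrightarrow> poly_fun (\<lambda>x. \<Sum>i\<in>S. f i x)"
  by (induction S rule: infinite_finite_induct) (auto intro: poly_fun.intros)

lemma poly_fun_prod: "(\<And>i. i \<in> S \<Longrightarrow> poly_fun (f i)) \<Longrightarrow> poly_fun (\<lambda>x. \<Prod>i\<in>S. f i x)"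
  by (induction S rule: infinite_finite_induct) (auto intro: poly_fun.intros)

lemma poly_fun_det_on: "(\<And>i j. poly_fun (\<lambda>x. M x i j)) \<Longrightarrow> poly_fun (\<lambda>x. det_on S (M x))"
  unfolding det_on_def by (intro poly_fun_sum poly_fun.mult poly_fun.const poly_fun_prod)

section \<open>The unitary group\<close>

lemma ctrans_nth [simp]: "ctrans A $ i $ j = cnj (A $ j $ i)"
  by (simp add: ctrans_def)

lemma matrix_mult_nth: "(A ** B) $ i $ j = (\<Sum>k\<in>UNIV. A $ i $ k * B $ k $ j)"
  by (simp add: matrix_matrix_mult_def)

lemma ctrans_mult: "ctrans (A ** B) = ctrans B ** ctrans A"
  by (simp add: vec_eq_iff matrix_mult_nth mult.commute)

lemma ctrans_ctrans [simp]: "ctrans (ctrans A) = A"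
  by (simp add: vec_eq_iff)

lemma ctrans_one [simp]: "ctrans (mat 1) = mat 1"
  by (simp add: vec_eq_iff mat_def)

lemma UK_inverse: "x \<in> UK \<Longrightarrow> x ** ctrans x = mat 1 \<and> ctrans x ** x = mat 1"
  by (auto simp: UK_def matrix_left_right_inverse)

lemma UK_ctrans: "x \<in> UK \<Longrightarrow> ctrans x \<in> UK"
  using UK_inverse by (auto simp: UK_def)

lemma UK_mult:
  assumes "x \<in> UK" "y \<in> UK"
  shows "x ** y \<in> UK"
proof -
  have "(x ** y) ** ctrans (x ** y) = x ** (y ** ctrans y) ** ctrans x"
    by (simp add: ctrans_mult matrix_mul_assoc)
  then show ?thesis
    using assms by (simp add: UK_def)
qed

lemma UK_one: "mat 1 \<in> UK"
  by (simp add: UK_def)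

lemma TK_mult_right: "t \<in> TK \<Longrightarrow> (x ** t) $ a $ b = x $ a $ b * t $ b $ b"
  unfolding matrix_mult_nth by (subst sum.remove[of _ b]) (auto simp: TK_def intro!: sum.neutral)

lemma TK_mult_left: "t \<in> TK \<Longrightarrow> (t ** x) $ a $ b = t $ a $ a * x $ a $ b"
  unfolding matrix_mult_nth by (subst sum.remove[of _ a]) (auto simp: TK_def intro!: sum.neutral)

lemma TK_norm: "t \<in> TK \<Longrightarrow> cmod (t $ a $ a) = 1"
  by (simp add: TK_def)

lemma TK_nz: "t \<in> TK \<Longrightarrow> t $ a $ a \<noteq> 0"
  using TK_norm[of t a] by auto

lemma TK_imp_UK:
  assumes t: "t \<in> TK"
  shows "t \<in> UK"
proof -
  have "t $ i $ i * cnj (t $ i $ i) = 1" for i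
    using TK_norm[OF t, of i] by (simp add: complex_norm_square[symmetric])
  then have "t ** ctrans t = mat 1"
    using t by (auto simp: vec_eq_iff TK_mult_left[OF t] mat_def TK_def)
  then show ?thesis
    by (simp add: UK_def)
qed

lemma chi_unit: "cmod z = 1 \<Longrightarrow> chi N z = z powi N"
  by (simp add: chi_def)

text \<open>Weights are indexed by the matrix indices rather than by positions, because they are
  read along two enumerations, \<open>row_order n idx\<close> and \<open>idx\<close>. On the torus,
  integer powers agree with \<open>chi\<close>.\<close>

definition chr :: "('m \<Rightarrow> int) \<Rightarrow> complex^'m::finite^'m \<Rightarrow> complex" where
  "chr w t = (\<Prod>a\<in>UNIV. (t $ a $ a) powi w a)"

lemma chr_add: "t \<in> TK \<Longrightarrow> chr (\<lambda>a. v a + w a) t = chr v t * chr w t"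
  by (simp add: chr_def power_int_add TK_nz prod.distrib)

lemma chr_zero [simp]: "chr (\<lambda>a. 0) t = 1"
  by (simp add: chr_def)

text \<open>The cocharacter with exponents \<open>r\<close>: composed with a weight it gives the
  power of \<open>z\<close> whose exponent is the pairing of the two.\<close>

definition diagm :: "('m \<Rightarrow> int) \<Rightarrow> complex \<Rightarrow> complex^'m::finite^'m" where
  "diagm r z = (\<chi> i j. if i = j then z powi r i else 0)"

lemma diagm_TK: "cmod z = 1 \<Longrightarrow> diagm r z \<in> TK"
  by (simp add: TK_def diagm_def norm_power_int)

lemma power_int_sum_exponent: "(z::complex) \<noteq> 0 \<Longrightarrow> (\<Prod>a\<in>A. z powi f a) = z powi (\<Sum>a\<in>A. f a)"
  by (induction A rule: infinite_finite_induct) (auto simp: power_int_add)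

lemma chr_diagm:
  assumes "cmod z = 1"
  shows "chr w (diagm r z) = z powi (\<Sum>a\<in>UNIV. r a * w a)"
proof -
  have "z \<noteq> 0"
    using assms by auto
  then show ?thesis
    by (simp add: chr_def diagm_def power_int_mult[symmetric] power_int_sum_exponent)
qed

section \<open>Spaces of functions\<close>

interpretation cfun: vector_space "\<lambda>(c::complex) (f::'a \<Rightarrow> complex) x. c * f x"
  by unfold_locales (auto simp: fun_eq_iff algebra_simps)

lemma csubspace_iff: "csubspace V \<longleftrightarrow> cfun.subspace V"
  by (simp add: csubspace_def cfun.subspace_def zero_fun_def plus_fun_def)

lemma sum_fun_apply: "(\<Sum>i\<in>A. f i) x = (\<Sum>i\<in>A. f i (x::'a) :: complex)"
  by (induction A rule: infinite_finite_induct) auto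

lemma cfun_span_finite_subset_cspan:
  assumes "finite B"
  shows "cfun.span B \<subseteq> cspan B"
  unfolding cfun.span_finite[OF assms] cspan_def by (auto simp: fun_eq_iff sum_fun_apply)

lemma cfun_span_products:
  assumes "F \<in> cfun.span A" "G \<in> cfun.span B" "\<And>a b. a \<in> A \<Longrightarrow> b \<in> B \<Longrightarrow> (\<lambda>x. a x * b x) \<in> C"
  shows "(\<lambda>x. F x * G x) \<in> cfun.span C"
  using assms(1)
proof (induction rule: cfun.span_induct_alt)
  case base
  then show ?case
    using cfun.span_zero[of C] by (simp add: zero_fun_def)
next
  case (step c a F')
  have "(\<lambda>x. a x * G x) \<in> cfun.span C"
    using assms(2)
  proof (induction rule: cfun.span_induct_alt)
    case base
    then show ?case
      using cfun.span_zero[of C] by (simp add: zero_fun_def)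
  next
    case (step c' b G')
    have "(\<lambda>x. c' * (a x * b x)) + (\<lambda>x. a x * G' x) \<in> cfun.span C"
      by (intro cfun.span_add cfun.span_scale cfun.span_base assms(3) \<open>a \<in> A\<close> step)
    then show ?case
      by (simp add: plus_fun_def algebra_simps)
  qed
  then have "(\<lambda>x. c * (a x * G x)) + (\<lambda>x. F' x * G x) \<in> cfun.span C"
    by (intro cfun.span_add cfun.span_scale step)
  then show ?case
    by (simp add: plus_fun_def algebra_simps)
qed

lemma iota_UK [simp]: "k \<in> UK \<Longrightarrow> iota F k = F k"
  by (simp add: iota_def)

lemma iota_notin [simp]: "k \<notin> UK \<Longrightarrow> iota F k = 0"
  by (simp add: iota_def)

lemma iota_span:
  assumes "F \<in> cfun.span A"
  shows "iota F \<in> cfun.span (iota ` A)"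
  using assms
proof (induction rule: cfun.span_induct_alt)
  case base
  have "iota (0::complex^'a^'a \<Rightarrow> complex) = 0"
    by (auto simp: iota_def)
  then show ?case
    using cfun.span_zero by metis
next
  case (step c a F)
  have "iota ((\<lambda>x. c * a x) + F) = (\<lambda>x. c * iota a x) + iota F"
    by (auto simp: iota_def)
  moreover have "(\<lambda>x. c * iota a x) + iota F \<in> cfun.span (iota ` A)"
    using step by (intro cfun.span_add cfun.span_scale) (auto intro: cfun.span_base)
  ultimately show ?case
    by (simp only:)
qed

section \<open>Kernel expansions\<close>

lemma eq_of_partial_sums:
  fixes u v :: "nat \<Rightarrow> int"
  assumes "\<And>j. j \<in> {1..d} \<Longrightarrow> (\<Sum>a=1..j. u a) = (\<Sum>a=1..j. v a)" and a: "a \<in> {1..d}"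
  shows "u a = v a"
proof -
  obtain b where b: "a = Suc b"
    using a by (cases a) auto
  have "(\<Sum>a=1..b. u a) = (\<Sum>a=1..b. v a)"
    using assms(1)[of b] a b by (cases "b = 0") auto
  then show ?thesis
    using assms(1)[OF a] b by simp
qed

lemma dominated_add:
  assumes "dominated d u A" "dominated d v B"
  shows "dominated d (\<lambda>a. u a + v a) (\<lambda>a. A a + B a)"
  using assms by (auto simp: dominated_def sum.distrib intro: add_mono)

text \<open>Two inequalities between partial sums that add up to an equality are both equalities.
  Hence a product of weight vectors reaches the extremal weight only if each factor does.\<close>

lemma dominated_add_eq:
  assumes u: "dominated d u A" and v: "dominated d v B"
    and eq: "\<And>a. a \<in> {1..d} \<Longrightarrow> u a + v a = A a + B a" and a: "a \<in> {1..d}"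
  shows "u a = A a"
proof (rule eq_of_partial_sums[OF _ a])
  fix j assume j: "j \<in> {1..d}"
  have "(\<Sum>a=1..j. u a + v a) = (\<Sum>a=1..j. A a + B a)"
    using j eq by (intro sum.cong) auto
  moreover have "(\<Sum>a=1..j. u a) \<le> (\<Sum>a=1..j. A a)" "(\<Sum>a=1..j. v a) \<le> (\<Sum>a=1..j. B a)"
    using j u v by (auto simp: dominated_def)
  ultimately show "(\<Sum>a=1..j. u a) = (\<Sum>a=1..j. A a)"
    by (simp add: sum.distrib)
qed

text \<open>Enumerating the indices as s 1, \<dots>, s d plays the role of choosing a Borel subgroup. The
  function m has right weight w, and f is the function whose extremal weight is Lam.\<close>
definition extremal_term :: "(nat \<Rightarrow> 'm) \<Rightarrow> nat \<Rightarrow> (nat \<Rightarrow> int) \<Rightarrow> (complex^'m::finite^'m \<Rightarrow> complex)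
    \<Rightarrow> (complex^'m^'m \<Rightarrow> complex) \<Rightarrow> ('m \<Rightarrow> int) \<Rightarrow> bool" where
  "extremal_term s d Lam f m w \<longleftrightarrow> poly_fun m
    \<and> (\<forall>t\<in>TK. \<forall>x. m (x ** t) = chr w t * m x)
    \<and> (\<forall>r. bij_betw r {1..d} UNIV \<longrightarrow> dominated d (\<lambda>a. w (r a)) Lam)
    \<and> (m (mat 1) \<noteq> 0 \<longrightarrow> (\<forall>a\<in>{1..d}. w (s a) = Lam a))
    \<and> ((\<forall>a\<in>{1..d}. w (s a) = Lam a) \<longrightarrow> (\<exists>c. \<forall>x. m x = c * f x))"

text \<open>The expansion is a list, since different products of minors may be the same function and
  must then count with multiplicity; weights are stored alongside because a zero function determines
  none. \<open>F\<close> is carried along so that its membership in the span follows the same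
  products as \<open>f\<close>.\<close>

definition extremal_kernel :: "(nat \<Rightarrow> 'm) \<Rightarrow> nat \<Rightarrow> (nat \<Rightarrow> int) \<Rightarrow> (complex^'m::finite^'m \<Rightarrow> complex)
    \<Rightarrow> (complex^'m^'m \<Rightarrow> complex) \<Rightarrow> bool" where
  "extremal_kernel s d Lam f F \<longleftrightarrow> f (mat 1) = 1
    \<and> (\<forall>t\<in>TK. \<forall>x. f (t ** x) = (\<Prod>a=1..d. (t $ s a $ s a) powi Lam a) * f x)
    \<and> (\<exists>xs. (\<forall>x y. f (x ** ctrans y) = (\<Sum>p\<leftarrow>xs. fst p x * cnj (fst p y)))
        \<and> (\<forall>p\<in>set xs. extremal_term s d Lam f (fst p) (snd p))
        \<and> F \<in> cfun.span (fst ` set xs))"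

lemma extremal_term_mult:
  assumes s: "bij_betw s {1..d} (UNIV :: 'm::finite set)"
    and 1: "extremal_term s d A f m w" and 2: "extremal_term s d B g m' w'"
  shows "extremal_term s d (\<lambda>a. A a + B a) (\<lambda>x. f x * g x) (\<lambda>x. m x * m' x) (\<lambda>a. w a + w' a)"
  unfolding extremal_term_def
proof (intro conjI ballI allI impI)
  show "poly_fun (\<lambda>x. m x * m' x)"
    using 1 2 by (auto simp: extremal_term_def intro: poly_fun.mult)
  show "m (x ** t) * m' (x ** t) = chr (\<lambda>a. w a + w' a) t * (m x * m' x)" if "t \<in> TK" for t x
    using 1 2 that by (simp add: extremal_term_def chr_add)
  show "dominated d (\<lambda>a. w (r a) + w' (r a)) (\<lambda>a. A a + B a)" if "bij_betw r {1..d} UNIV" for r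
    using 1 2 that dominated_add unfolding extremal_term_def by blast
  show "w (s a) + w' (s a) = A a + B a"
    if "m (mat 1) * m' (mat 1) \<noteq> 0" "a \<in> {1..d}" for a
    using 1 2 that by (auto simp: extremal_term_def)
  assume eq: "\<forall>a\<in>{1..d}. w (s a) + w' (s a) = A a + B a"
  have dom: "dominated d (\<lambda>a. w (s a)) A" "dominated d (\<lambda>a. w' (s a)) B"
    using 1 2 s by (auto simp: extremal_term_def)
  have "\<forall>a\<in>{1..d}. w (s a) = A a"
    using dominated_add_eq[OF dom] eq by auto
  moreover from this have "\<forall>a\<in>{1..d}. w' (s a) = B a"
    using eq by auto
  ultimately obtain c c' where "\<forall>x. m x = c * f x" "\<forall>x. m' x = c' * g x"
    using 1 2 by (auto simp: extremal_term_def)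
  then show "\<exists>c. \<forall>x. m x * m' x = c * (f x * g x)"
    by (intro exI[of _ "c * c'"]) (simp add: mult_ac)
qed

lemma sum_list_product:
  fixes f :: "'a \<Rightarrow> complex"
  shows "(\<Sum>p\<leftarrow>List.product xs ys. f (fst p) * g (snd p)) = (\<Sum>x\<leftarrow>xs. f x) * (\<Sum>y\<leftarrow>ys. g y)"
  by (induction xs) (simp_all add: o_def sum_list_const_mult distrib_right)

text \<open>The product of two expansions is the expansion over pairs, with weights added and
  coefficients still 1. On representations this is the passage to the Cartan product, whose extremal
  weight is the sum.\<close>

lemma extremal_kernel_mult:
  assumes s: "bij_betw s {1..d} (UNIV :: 'm::finite set)"
    and 1: "extremal_kernel s d A f F" and 2: "extremal_kernel s d B g G"
  shows "extremal_kernel s d (\<lambda>a. A a + B a) (\<lambda>x. f x * g x) (\<lambda>x. F x * G x)"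
proof -
  obtain xs where xs: "\<And>x y. f (x ** ctrans y) = (\<Sum>p\<leftarrow>xs. fst p x * cnj (fst p y))"
    "\<forall>p\<in>set xs. extremal_term s d A f (fst p) (snd p)" "F \<in> cfun.span (fst ` set xs)"
    using 1 by (auto simp: extremal_kernel_def)
  obtain ys where ys: "\<And>x y. g (x ** ctrans y) = (\<Sum>p\<leftarrow>ys. fst p x * cnj (fst p y))"
    "\<forall>p\<in>set ys. extremal_term s d B g (fst p) (snd p)" "G \<in> cfun.span (fst ` set ys)"
    using 2 by (auto simp: extremal_kernel_def)
  define h :: "((complex^'m^'m \<Rightarrow> complex) \<times> ('m \<Rightarrow> int)) \<times> ((complex^'m^'m \<Rightarrow> complex) \<times> ('m \<Rightarrow> int))
      \<Rightarrow> ((complex^'m^'m \<Rightarrow> complex) \<times> ('m \<Rightarrow> int))"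
    where "h = (\<lambda>(p, q). ((\<lambda>x. fst p x * fst q x), (\<lambda>a. snd p a + snd q a)))"
  let ?zs = "map h (List.product xs ys)"
  have "f (x ** ctrans y) * g (x ** ctrans y) = (\<Sum>p\<leftarrow>?zs. fst p x * cnj (fst p y))" for x y
    unfolding xs(1) ys(1) sum_list_product[symmetric]
    by (simp add: o_def h_def case_prod_unfold mult_ac)
  moreover have "extremal_term s d (\<lambda>a. A a + B a) (\<lambda>x. f x * g x) (fst p) (snd p)"
    if "p \<in> set ?zs" for p
    using that xs(2) ys(2) by (fastforce simp: h_def intro!: extremal_term_mult[OF s])
  moreover have "(\<lambda>x. F x * G x) \<in> cfun.span (fst ` set ?zs)"
  proof (rule cfun_span_products[OF xs(3) ys(3)])
    fix a b assume "a \<in> fst ` set xs" "b \<in> fst ` set ys"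
    then obtain p q where "p \<in> set xs" "q \<in> set ys" "a = fst p" "b = fst q"
      by auto
    then show "(\<lambda>x. a x * b x) \<in> fst ` set ?zs"
      by (intro image_eqI[of _ _ "h (p, q)"]) (auto simp: h_def)
  qed
  moreover have "f (mat 1) * g (mat 1) = 1"
    using 1 2 by (simp add: extremal_kernel_def)
  moreover have "f (t ** x) * g (t ** x) = (\<Prod>a=1..d. (t $ s a $ s a) powi (A a + B a)) * (f x * g x)"
    if "t \<in> TK" for t x
    using 1 2 that by (simp add: extremal_kernel_def power_int_add TK_nz prod.distrib)
  ultimately show ?thesis
    unfolding extremal_kernel_def by blast
qed

lemma extremal_kernel_one: "extremal_kernel s d (\<lambda>a. 0) (\<lambda>x. 1) (\<lambda>x. 1)"
  unfolding extremal_kernel_def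
proof (intro conjI exI[of _ "[(\<lambda>x. 1, \<lambda>a. 0)]"])
  show "\<forall>p\<in>set [(\<lambda>x. 1, \<lambda>a. 0)]. extremal_term s d (\<lambda>a. 0) (\<lambda>x. 1) (fst p) (snd p)"
    by (auto simp: extremal_term_def dominated_def intro: poly_fun.const)
qed (auto intro: cfun.span_base)

lemma extremal_kernel_power:
  assumes s: "bij_betw s {1..d} (UNIV :: 'm::finite set)" and "extremal_kernel s d A f F"
  shows "extremal_kernel s d (\<lambda>a. int k * A a) (\<lambda>x. f x ^ k) (\<lambda>x. F x ^ k)"
proof (induction k)
  case 0
  show ?case
    using extremal_kernel_one by simp
next
  case (Suc k)
  show ?case
    using extremal_kernel_mult[OF s assms(2) Suc] by (simp add: algebra_simps)
qed

lemma extremal_kernel_prod: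
  assumes s: "bij_betw s {1..d} (UNIV :: 'm::finite set)"
    and "\<And>i. i \<in> I \<Longrightarrow> extremal_kernel s d (A i) (f i) (F i)"
  shows "extremal_kernel s d (\<lambda>a. \<Sum>i\<in>I. A i a) (\<lambda>x. \<Prod>i\<in>I. f i x) (\<lambda>x. \<Prod>i\<in>I. F i x)"
  using assms(2)
proof (induction I rule: infinite_finite_induct)
  case (insert i I)
  then show ?case
    using extremal_kernel_mult[OF s] by simp
qed (simp_all add: extremal_kernel_one)

section \<open>Projection onto weights of a one-parameter torus\<close>

text \<open>A geometric sum over the \<open>M\<close>-th roots of unity vanishes unless its ratio is
  1; this finite average takes the place of an integral over the circle.\<close>

lemma unit_root_filter:
  fixes Q :: "int set"
  assumes "finite Q"
  obtains M :: nat and z :: complex where "M > 0" "cmod z = 1"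
    "\<And>q. q \<in> Q \<Longrightarrow> (\<Sum>j<M. (z ^ j) powi q) = (if q = 0 then of_nat M else 0)"
proof
  define M where "M = Suc (\<Sum>q\<in>Q. nat \<bar>q\<bar>)"
  define z where "z = cis (2 * pi / real M)"
  show M: "M > 0" and "cmod z = 1"
    by (simp_all add: M_def z_def)
  fix q assume q: "q \<in> Q"
  have "nat \<bar>q\<bar> \<le> (\<Sum>q\<in>Q. nat \<bar>q\<bar>)"
    using assms q by (intro member_le_sum) auto
  then have "nat \<bar>q\<bar> < M"
    unfolding M_def less_Suc_eq_le .
  then have small: "\<bar>q\<bar> < int M"
    by linarith
  have pow: "(z ^ j) powi q = (z powi q) ^ j" for j
    by (simp add: power_int_power power_int_power' mult.commute)
  show "(\<Sum>j<M. (z ^ j) powi q) = (if q = 0 then of_nat M else 0)"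
  proof (cases "q = 0")
    case False
    have zq: "z powi q = cis (of_int q * (2 * pi / real M))"
      by (simp add: z_def cis_power_int)
    have "z powi q \<noteq> 1"
    proof
      assume "z powi q = 1"
      then have "cos (of_int q * (2 * pi / real M)) = 1"
        using zq by (metis cis.sel(1) one_complex.sel(1))
      then obtain i :: int where "of_int q * (2 * pi / real M) = of_int i * 2 * pi"
        using cos_one_2pi_int by auto
      then have "real_of_int q = real_of_int (i * int M)"
        using M by (simp add: field_simps)
      then have "q = i * int M"
        by (simp only: of_int_eq_iff)
      then show False
        using small False by (auto simp: abs_mult)
    qed
    moreover have "(z powi q) ^ M = 1"
    proof -
      have "(z powi q) ^ M = (z ^ M) powi q"
        by (simp add: power_int_power power_int_power' mult.commute)
      also have "z ^ M = 1"
        using M by (simp add: z_def Complex.DeMoivre)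
      finally show ?thesis by simp
    qed
    ultimately show ?thesis
      using False by (simp add: pow geometric_sum)
  qed (simp add: pow)
qed

lemma Rtr_add: "Rtr k (f + g) = Rtr k f + Rtr k g"
  by (auto simp: Rtr_def fun_eq_iff)

lemma Rtr_scale: "Rtr k (\<lambda>x. c * f x) = (\<lambda>x. c * Rtr k f x)"
  by (auto simp: Rtr_def fun_eq_iff)

lemma Rtr_Rtr: "k \<in> UK \<Longrightarrow> Rtr k (Rtr k' f) = Rtr (k ** k') f"
  by (auto simp: Rtr_def fun_eq_iff UK_mult matrix_mul_assoc)

definition weight_space :: "('m::finite \<Rightarrow> int) \<Rightarrow> (complex^'m^'m \<Rightarrow> complex) set" where
  "weight_space w = {f. \<forall>t\<in>TK. Rtr t f = (\<lambda>x. chr w t * f x)}"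

lemma sum_fun_mem_subspace:
  "cfun.subspace V \<Longrightarrow> (\<And>i. i \<in> A \<Longrightarrow> (\<lambda>x. f i x) \<in> V) \<Longrightarrow> (\<lambda>x. \<Sum>i\<in>A. f i x) \<in> V"
  using cfun.subspace_sum[of V A f] by (simp add: sum_fun_apply fun_eq_iff[symmetric])
     (simp add: sum_fun_apply[symmetric])

text \<open>Averaging translates along the cocharacter \<open>r\<close>, twisted by the exponent
  \<open>- r0\<close>, keeps exactly those weights of \<open>Ws\<close> whose pairing with
  \<open>r\<close> is \<open>r0\<close>. Being a combination of right translates, the operator
  preserves every invariant subspace.\<close>

lemma torus_projection:
  fixes r :: "'m::finite \<Rightarrow> int" and r0 :: int
  assumes "finite Ws"
  obtains T :: "(complex^'m^'m \<Rightarrow> complex) \<Rightarrow> (complex^'m^'m \<Rightarrow> complex)" where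
    "\<And>f g. T (f + g) = T f + T g"
    "\<And>c f. T (\<lambda>x. c * f x) = (\<lambda>x. c * T f x)"
    "\<And>V f. csubspace V \<Longrightarrow> Kinvariant V \<Longrightarrow> f \<in> V \<Longrightarrow> T f \<in> V"
    "\<And>w f. w \<in> Ws \<Longrightarrow> f \<in> weight_space w \<Longrightarrow> T f = (if (\<Sum>a\<in>UNIV. r a * w a) = r0 then f else 0)"
proof -
  define ev where "ev w = (\<Sum>a\<in>UNIV. r a * w a)" for w
  obtain M z where M: "M > (0::nat)" and z: "cmod z = 1" and
    filter: "\<And>q. q \<in> (\<lambda>w. ev w - r0) ` Ws \<Longrightarrow> (\<Sum>j<M. (z ^ j) powi q) = (if q = 0 then of_nat M else 0)"
    using unit_root_filter[of "(\<lambda>w. ev w - r0) ` Ws"] assms by blast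
  have zj: "cmod (z ^ j) = 1" "z ^ j \<noteq> 0" for j
    using z by (auto simp: norm_power)
  define T where "T f = (\<lambda>x. \<Sum>j<M. (z ^ j) powi (- r0) / of_nat M * Rtr (diagm r (z ^ j)) f x)"
    for f :: "complex^'m^'m \<Rightarrow> complex"
  show ?thesis
  proof
    show "T (f + g) = T f + T g" for f g
      by (auto simp: T_def fun_eq_iff Rtr_add distrib_left add_divide_distrib sum.distrib)
    show "T (\<lambda>x. c * f x) = (\<lambda>x. c * T f x)" for c f
      by (auto simp: T_def fun_eq_iff Rtr_scale sum_distrib_left mult_ac)
    show "T f \<in> V" if V: "csubspace V" "Kinvariant V" "f \<in> V" for V f
    proof -
      have "(\<lambda>x. (z ^ j) powi (- r0) / of_nat M * Rtr (diagm r (z ^ j)) f x) \<in> V" for j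
      proof -
        have "Rtr (diagm r (z ^ j)) f \<in> V"
          using V(2,3) TK_imp_UK[OF diagm_TK[OF zj(1)]] by (auto simp: Kinvariant_def)
        then show ?thesis
          using V(1) by (intro cfun.subspace_scale) (simp add: csubspace_iff)
      qed
      then show ?thesis
        unfolding T_def using V(1) by (intro sum_fun_mem_subspace) (auto simp: csubspace_iff)
    qed
    fix w f assume w: "w \<in> Ws" and f: "f \<in> weight_space w"
    have "T f x = (if ev w = r0 then f x else 0)" for x
    proof -
      have "(z ^ j) powi (- r0) / of_nat M * Rtr (diagm r (z ^ j)) f x
          = (z ^ j) powi (ev w - r0) * (f x / of_nat M)" for j
        using f diagm_TK[OF zj(1)[of j], of r] power_int_add[of "z ^ j" "- r0" "ev w"] zj
        by (simp add: weight_space_def chr_diagm ev_def field_simps)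
      then have "T f x = (\<Sum>j<M. (z ^ j) powi (ev w - r0)) * (f x / of_nat M)"
        unfolding T_def sum_distrib_right by (intro sum.cong refl)
      then show ?thesis
        using filter[of "ev w - r0"] w M by auto
    qed
    then show "T f = (if (\<Sum>a\<in>UNIV. r a * w a) = r0 then f else 0)"
      by (auto simp: ev_def fun_eq_iff)
  qed
qed

section \<open>The span of a positive kernel\<close>

text \<open>A basis of the span of \<open>A\<close> stays independent when \<open>m\<close> is
  added, so values on it can be prescribed. \<open>A\<close> may be infinite, as the set of all
  translates of a function is.\<close>

lemma cfun_separating_functional:
  assumes "m \<notin> cfun.span A"
  obtains \<phi> :: "('a \<Rightarrow> complex) \<Rightarrow> complex" where
    "\<And>f g. \<phi> (f + g) = \<phi> f + \<phi> g" "\<And>c f. \<phi> (\<lambda>x. c * f x) = c * \<phi> f"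
    "\<And>f. f \<in> A \<Longrightarrow> \<phi> f = 0" "\<phi> m = 1"
proof -
  interpret pair: vector_space_pair "\<lambda>(c::complex) (f::'a \<Rightarrow> complex) x. c * f x" "(*) :: complex \<Rightarrow> _"
    by (intro vector_space_pair.intro cfun.vector_space_axioms vector_space_over_itself.vector_space_axioms)
  obtain B where B: "B \<subseteq> A" "cfun.independent B" "A \<subseteq> cfun.span B"
    using cfun.maximal_independent_subset by blast
  have m: "m \<notin> cfun.span B"
    using assms B(1) cfun.span_mono by blast
  then have "cfun.independent (insert m B)"
    using B(2) by (rule cfun.independent_insertI)
  then obtain \<phi> where lin: "Vector_Spaces.linear (\<lambda>(c::complex) (f::'a \<Rightarrow> complex) x. c * f x) (*) \<phi>"
    and \<phi>: "\<forall>x\<in>insert m B. \<phi> x = (if x = m then 1 else 0)"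
    using pair.linear_independent_extend[of "insert m B" "\<lambda>x. if x = m then 1 else 0"] by blast
  interpret lin: Vector_Spaces.linear "\<lambda>(c::complex) (f::'a \<Rightarrow> complex) x. c * f x" "(*)" \<phi>
    by (rule lin)
  have "\<phi> f = 0" if "f \<in> cfun.span B" for f
    using that
  proof (induction rule: cfun.span_induct_alt)
    case (step c b g)
    moreover have "b \<noteq> m"
      using step m cfun.span_base by blast
    ultimately show ?case
      unfolding lin.add lin.scale using \<phi> by simp
  qed (rule lin.zero)
  then have "\<phi> f = 0" if "f \<in> A" for f
    using that B(3) by blast
  moreover have "\<phi> m = 1"
    using \<phi> by simp
  ultimately show ?thesis
    by (intro that[of \<phi>] lin.add lin.scale)
qed

lemma linear_sum_list:
  fixes \<phi> :: "('a \<Rightarrow> complex) \<Rightarrow> complex"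
  assumes "\<And>f g. \<phi> (f + g) = \<phi> f + \<phi> g" "\<And>c f. \<phi> (\<lambda>x. c * f x) = c * \<phi> f"
  shows "\<phi> (\<lambda>x. \<Sum>p\<leftarrow>xs. c p * g p x) = (\<Sum>p\<leftarrow>xs. c p * \<phi> (g p))"
proof (induction xs)
  case Nil
  then show ?case
    using assms(2)[of 0 "\<lambda>x. 0"] by simp
next
  case (Cons p xs)
  have "\<phi> (\<lambda>x. \<Sum>p\<leftarrow>p # xs. c p * g p x)
      = \<phi> ((\<lambda>x. c p * g p x) + (\<lambda>x. \<Sum>p\<leftarrow>xs. c p * g p x))"
    by (simp add: plus_fun_def)
  then show ?case
    by (simp only: assms Cons) simp
qed

lemma sum_list_mem_subspace:
  assumes "cfun.subspace V" "\<And>p. p \<in> set xs \<Longrightarrow> g p \<in> V"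
  shows "(\<lambda>x. \<Sum>p\<leftarrow>xs. c p * g p x) \<in> V"
  using assms(2)
proof (induction xs)
  case Nil
  then show ?case
    using cfun.subspace_0[OF assms(1)] by (simp add: zero_fun_def)
next
  case (Cons p xs)
  have "(\<lambda>x. c p * g p x) + (\<lambda>x. \<Sum>p\<leftarrow>xs. c p * g p x) \<in> V"
    using Cons by (intro cfun.subspace_add[OF assms(1)] cfun.subspace_scale[OF assms(1)]) auto
  then show ?case
    by (simp add: plus_fun_def)
qed

text \<open>A functional annihilating all kernel functions is applied to the function that is thereby
  forced to vanish; the result is a sum of squares.\<close>
lemma span_kernel_functions:
  fixes g :: "'p \<Rightarrow> 'a \<Rightarrow> complex"
  assumes off: "\<And>p x. p \<in> set xs \<Longrightarrow> x \<notin> Y \<Longrightarrow> g p x = 0" and p0: "p0 \<in> set xs"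
  shows "g p0 \<in> cfun.span ((\<lambda>y x. \<Sum>p\<leftarrow>xs. cnj (g p y) * g p x) ` Y)"
proof (rule ccontr)
  assume "\<not> ?thesis"
  then obtain \<phi> where lin: "\<And>f g. \<phi> (f + g) = \<phi> f + \<phi> g" "\<And>c f. \<phi> (\<lambda>x. c * f x) = c * \<phi> f"
    and ker: "\<And>f. f \<in> (\<lambda>y x. \<Sum>p\<leftarrow>xs. cnj (g p y) * g p x) ` Y \<Longrightarrow> \<phi> f = 0" and 1: "\<phi> (g p0) = 1"
    by (rule cfun_separating_functional) blast
  have cnj_sum_list: "cnj (\<Sum>p\<leftarrow>ys. h p) = (\<Sum>p\<leftarrow>ys. cnj (h p))" for ys and h :: "'p \<Rightarrow> complex"
    by (induction ys) auto
  \<comment> \<open>At a point of \<open>Y\<close> this is the conjugate of the annihilation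
    condition; elsewhere every summand vanishes by \<open>off\<close>. So the combination is zero as
    a function, and \<open>\<phi>\<close> can be applied to it.\<close>
  have "(\<Sum>p\<leftarrow>xs. cnj (\<phi> (g p)) * g p y) = 0" for y
  proof (cases "y \<in> Y")
    case True
    have "0 = \<phi> (\<lambda>x. \<Sum>p\<leftarrow>xs. cnj (g p y) * g p x)"
      using ker True by simp
    also have "\<dots> = (\<Sum>p\<leftarrow>xs. cnj (g p y) * \<phi> (g p))"
      by (rule linear_sum_list[OF lin])
    finally have "cnj (\<Sum>p\<leftarrow>xs. cnj (g p y) * \<phi> (g p)) = 0"
      by simp
    then show ?thesis
      by (simp add: cnj_sum_list mult.commute)
  next
    case False
    then have "(\<Sum>p\<leftarrow>xs. cnj (\<phi> (g p)) * g p y) = (\<Sum>p\<leftarrow>xs. 0)"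
      using off by (intro arg_cong[of _ _ sum_list] map_cong) auto
    then show ?thesis by simp
  qed
  then have "0 = \<phi> (\<lambda>x. \<Sum>p\<leftarrow>xs. cnj (\<phi> (g p)) * g p x)"
    using lin(2)[of 0 "\<lambda>x. 0"] by simp
  also have "\<dots> = (\<Sum>p\<leftarrow>xs. cnj (\<phi> (g p)) * \<phi> (g p))"
    by (rule linear_sum_list[OF lin])
  also have "\<dots> = of_real (\<Sum>p\<leftarrow>xs. (cmod (\<phi> (g p)))\<^sup>2)"
    by (induction xs) (simp_all only: list.map sum_list.Nil sum_list.Cons of_real_0 of_real_add
        complex_norm_square mult.commute)
  finally have "(\<Sum>p\<leftarrow>xs. (cmod (\<phi> (g p)))\<^sup>2) = 0"
    by (metis of_real_eq_0_iff)
  then have "\<forall>v\<in>set (map (\<lambda>p. (cmod (\<phi> (g p)))\<^sup>2) xs). v = 0"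
    by (subst (asm) sum_list_nonneg_eq_0_iff) auto
  then have "(cmod (\<phi> (g p0)))\<^sup>2 = 0"
    using p0 by auto
  with 1 show False
    by simp
qed

section \<open>The irreducible constituent attached to a kernel expansion\<close>

lemma Kinvariant_span:
  fixes A :: "(complex^'m::finite^'m \<Rightarrow> complex) set"
  assumes "\<And>k f. k \<in> UK \<Longrightarrow> f \<in> A \<Longrightarrow> Rtr k f \<in> cfun.span A"
  shows "Kinvariant (cfun.span A)"
  unfolding Kinvariant_def
proof (intro ballI)
  fix k :: "complex^'m^'m" and f assume k: "k \<in> UK"
  assume "f \<in> cfun.span A"
  then show "Rtr k f \<in> cfun.span A"
  proof (induction rule: cfun.span_induct_alt)
    case base
    have "Rtr k (0::complex^'m^'m \<Rightarrow> complex) = 0"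
      by (auto simp: Rtr_def fun_eq_iff)
    then show ?case
      using cfun.span_zero by metis
  next
    case (step c f g)
    then show ?case
      unfolding Rtr_add Rtr_scale using assms k by (intro cfun.span_add cfun.span_scale) auto
  qed
qed

text \<open>Equal partial sums would give equal entries, so one of the inequalities is strict. The
  double sum is thus a single number that separates the extremal weight from all other dominated
  ones.\<close>

lemma dominated_strict_sum:
  assumes dom: "dominated d u v" and neq: "a \<in> {1..d}" "u a \<noteq> v a"
  shows "(\<Sum>j=1..d. \<Sum>a=1..j. u a) < (\<Sum>j=1..d. \<Sum>a=1..j. v a)"
proof -
  have le: "(\<Sum>a=1..j. u a) \<le> (\<Sum>a=1..j. v a)" if "j \<in> {1..d}" for j
    using dom that by (simp add: dominated_def)
  obtain j where "j \<in> {1..d}" "(\<Sum>a=1..j. u a) \<noteq> (\<Sum>a=1..j. v a)"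
    using eq_of_partial_sums[of d u v a] neq by blast
  then show ?thesis
    using le by (intro sum_strict_mono_ex1) (auto simp: less_le)
qed

text \<open>The entry \<open>u a\<close> occurs in the partial sums with \<open>j \<ge> a\<close>,
  which are \<open>d + 1 - a\<close> in number. This is the origin of the exponents of the
  one-parameter torus.\<close>

lemma sum_partial_sums:
  fixes u :: "nat \<Rightarrow> int"
  shows "(\<Sum>j=1..d. \<Sum>a=1..j. u a) = (\<Sum>a=1..d. (int d + 1 - int a) * u a)"
proof (induction d)
  case (Suc d)
  have "(\<Sum>a=1..Suc d. (int (Suc d) + 1 - int a) * u a)
      = (\<Sum>a=1..Suc d. (int d + 1 - int a) * u a + u a)"
    by (intro sum.cong) (auto simp: algebra_simps)
  then show ?case
    using Suc by (simp add: sum.distrib)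
qed simp

text \<open>Reordering the columns by a permutation matrix turns the extremal weight with respect to the
  order s into the one with respect to the order e.\<close>
lemma permutation_conjugation:
  assumes s: "bij_betw s {1..d} (UNIV :: 'm::finite set)" and e: "bij_betw e {1..d} (UNIV :: 'm set)"
  obtains k :: "complex^'m^'m" where "k \<in> UK"
    "\<And>t. t \<in> TK \<Longrightarrow> \<exists>t'\<in>TK. t ** k = k ** t' \<and> (\<forall>a\<in>{1..d}. t' $ s a $ s a = t $ e a $ e a)"
proof -
  define q where "q = (\<lambda>j. e (inv_into {1..d} s j))"
  have "bij_betw (e \<circ> inv_into {1..d} s) UNIV UNIV"
    by (rule bij_betw_trans[OF bij_betw_inv_into[OF s] e])
  then have q: "bij q"
    by (simp add: q_def o_def)
  have qs: "q (s a) = e a" if "a \<in> {1..d}" for a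
    using that s by (simp add: q_def bij_betw_inv_into_left)
  define k :: "complex^'m^'m" where "k = (\<chi> i j. if i = q j then 1 else 0)"
  show ?thesis
  proof
    have "(k ** ctrans k) $ i $ j = mat 1 $ i $ j" for i j
    proof -
      have "(k ** ctrans k) $ i $ j = (\<Sum>c\<in>UNIV. (if i = q c then 1 else 0) * (if j = q c then 1 else 0))"
        by (simp add: matrix_mult_nth k_def if_distrib cong: if_cong)
      also have "\<dots> = (\<Sum>b\<in>UNIV. (if i = b then 1 else 0) * (if j = b then 1 else 0))"
        by (rule sum.reindex_bij_betw[OF q])
      also have "\<dots> = (\<Sum>b\<in>UNIV. if i = b then if j = b then 1 else 0 else 0)"
        by (intro sum.cong) auto
      also have "\<dots> = mat 1 $ i $ j"
        by (auto simp: mat_def)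
      finally show ?thesis .
    qed
    then show "k \<in> UK"
      by (simp add: UK_def vec_eq_iff)
    fix t :: "complex^'m^'m" assume t: "t \<in> TK"
    define t' :: "complex^'m^'m" where "t' = (\<chi> i j. if i = j then t $ q i $ q i else 0)"
    have "t' \<in> TK"
      using t by (simp add: TK_def t'_def)
    moreover have "t ** k = k ** t'"
      by (simp add: vec_eq_iff TK_mult_left[OF t] TK_mult_right[OF \<open>t' \<in> TK\<close>]) (simp add: k_def t'_def)
    ultimately show "\<exists>t'\<in>TK. t ** k = k ** t' \<and> (\<forall>a\<in>{1..d}. t' $ s a $ s a = t $ e a $ e a)"
      by (intro bexI[of _ t']) (auto simp: t'_def qs)
  qed
qed

locale kernel_expansion =
  fixes s :: "nat \<Rightarrow> 'm::finite" and d :: nat and Lam :: "nat \<Rightarrow> int"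
    and f :: "complex^'m^'m \<Rightarrow> complex"
    and xs :: "((complex^'m^'m \<Rightarrow> complex) \<times> ('m \<Rightarrow> int)) list"
  assumes s: "bij_betw s {1..d} UNIV"
    and f_one: "f (mat 1) = 1"
    and left: "\<And>t x. t \<in> TK \<Longrightarrow> f (t ** x) = (\<Prod>a=1..d. (t $ s a $ s a) powi Lam a) * f x"
    and expansion: "\<And>x y. f (x ** ctrans y) = (\<Sum>p\<leftarrow>xs. fst p x * cnj (fst p y))"
    and terms: "\<And>p. p \<in> set xs \<Longrightarrow> extremal_term s d Lam f (fst p) (snd p)"
begin

definition W :: "(complex^'m^'m \<Rightarrow> complex) set" where
  "W = cfun.span (iota ` fst ` set xs)"

lemma subspace_W: "cfun.subspace W"
  by (simp add: W_def)

text \<open>This is the kernel at \<open>y = ctrans k\<close>, since \<open>k\<close> is the adjoint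
  of its adjoint; the coefficients are conjugated values of the terms at the inverse of
  \<open>k\<close>.\<close>

lemma translate_expansion:
  assumes "k \<in> UK"
  shows "Rtr k (iota f) = (\<lambda>x. \<Sum>p\<leftarrow>xs. cnj (iota (fst p) (ctrans k)) * iota (fst p) x)"
proof
  fix x
  show "Rtr k (iota f) x = (\<Sum>p\<leftarrow>xs. cnj (iota (fst p) (ctrans k)) * iota (fst p) x)"
    using expansion[of x "ctrans k"] assms UK_mult[of x k] UK_ctrans[OF assms]
    by (cases "x \<in> UK") (simp_all add: Rtr_def mult.commute)
qed

text \<open>Both descriptions of \<open>W\<close> are used: the terms give finite dimension,
  smoothness and weights, the translates give invariance and the left transformation law. Positivity
  of the kernel supplies the inclusion from left to right.\<close>

lemma W_eq_span_translates: "W = cfun.span ((\<lambda>k. Rtr k (iota f)) ` UK)"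
proof
  have "Rtr k (iota f) \<in> W" if "k \<in> UK" for k
    unfolding translate_expansion[OF that] using subspace_W
    by (rule sum_list_mem_subspace) (auto simp: W_def intro: cfun.span_base)
  then show "cfun.span ((\<lambda>k. Rtr k (iota f)) ` UK) \<subseteq> W"
    by (intro cfun.span_minimal[OF _ subspace_W]) auto
  let ?k = "\<lambda>y x. \<Sum>p\<leftarrow>xs. cnj (iota (fst p) y) * iota (fst p) x"
  have "?k y \<in> (\<lambda>k. Rtr k (iota f)) ` UK" if y: "y \<in> UK" for y
  proof (rule image_eqI)
    show "?k y = Rtr (ctrans y) (iota f)"
      unfolding translate_expansion[OF UK_ctrans[OF y]] ctrans_ctrans ..
  qed (rule UK_ctrans[OF y])
  then have "cfun.span (?k ` UK) \<subseteq> cfun.span ((\<lambda>k. Rtr k (iota f)) ` UK)"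
    by (intro cfun.span_mono) blast
  then have "iota (fst p) \<in> cfun.span ((\<lambda>k. Rtr k (iota f)) ` UK)" if "p \<in> set xs" for p
    using span_kernel_functions[of xs UK "\<lambda>p. iota (fst p)" p, OF iota_notin that] by blast
  then show "W \<subseteq> cfun.span ((\<lambda>k. Rtr k (iota f)) ` UK)"
    unfolding W_def by (intro cfun.span_minimal) auto
qed

lemma Kinvariant_W: "Kinvariant W"
  unfolding W_eq_span_translates
proof (rule Kinvariant_span)
  fix k :: "complex^'m^'m" and g assume k: "k \<in> UK" and "g \<in> (\<lambda>k. Rtr k (iota f)) ` UK"
  then obtain k' where k': "k' \<in> UK" "g = Rtr k' (iota f)"
    by auto
  have "Rtr k g = Rtr (k ** k') (iota f)"
    using Rtr_Rtr[OF k] k' by simp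
  then show "Rtr k g \<in> cfun.span ((\<lambda>k. Rtr k (iota f)) ` UK)"
    using UK_mult[OF k k'(1)] by (auto intro: cfun.span_base)
qed

lemma translate_mem_W: "k \<in> UK \<Longrightarrow> Rtr k (iota f) \<in> W"
  unfolding W_eq_span_translates by (auto intro: cfun.span_base)

lemma W_off: "g \<in> W \<Longrightarrow> x \<notin> UK \<Longrightarrow> g x = 0"
  unfolding W_def by (induction rule: cfun.span_induct_alt) auto

text \<open>Left and right multiplication commute, so every right translate inherits the left law of
  \<open>f\<close>.\<close>

lemma W_left:
  assumes "g \<in> W" and t: "t \<in> TK" and k: "k \<in> UK"
  shows "g (t ** k) = (\<Prod>a=1..d. (t $ s a $ s a) powi Lam a) * g k"
  using assms(1) unfolding W_eq_span_translates
proof (induction rule: cfun.span_induct_alt)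
  case (step c h g)
  then show ?case
    using t k left[OF t]
    by (auto simp: Rtr_def UK_mult TK_imp_UK matrix_mul_assoc[symmetric] algebra_simps)
qed simp

lemma W_smooth:
  assumes "g \<in> W"
  shows "smoothK g"
proof -
  have "\<exists>h. poly_fun h \<and> (\<forall>k\<in>UK. g k = h k)"
    using assms unfolding W_def
  proof (induction rule: cfun.span_induct_alt)
    case base
    then show ?case
      using poly_fun.const[of 0] by auto
  next
    case (step c h g)
    then obtain g' where g': "poly_fun g'" "\<forall>k\<in>UK. g k = g' k"
      by auto
    obtain p where p: "p \<in> set xs" "h = iota (fst p)"
      using step by auto
    have "poly_fun (\<lambda>x. c * fst p x + g' x)"
      using terms[OF p(1)] g' by (auto simp: extremal_term_def intro!: poly_fun.intros)
    then show ?case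
      using g' p by (intro exI[of _ "\<lambda>x. c * fst p x + g' x"]) auto
  qed
  then show ?thesis
    unfolding smoothK_def using poly_fun_smooth by blast
qed

lemma term_weight_space:
  assumes "p \<in> set xs"
  shows "iota (fst p) \<in> weight_space (snd p)"
  using terms[OF assms] UK_mult TK_imp_UK
  by (auto simp: weight_space_def extremal_term_def Rtr_def fun_eq_iff iota_def)

text \<open>Projecting to the pairing attained by \<open>Lam\<close> kills every term of another
  weight, and such terms vanish at the identity. A remaining term is \<open>c * f\<close> with
  \<open>c\<close> its value at the identity, as \<open>f (mat 1) = 1\<close>. The formula is linear
  and so extends to \<open>W\<close>.\<close>

lemma projection_onto_f:
  obtains T where "\<And>V g. csubspace V \<Longrightarrow> Kinvariant V \<Longrightarrow> g \<in> V \<Longrightarrow> T g \<in> V"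
    "\<And>g. g \<in> W \<Longrightarrow> T g = (\<lambda>x. g (mat 1) * iota f x)"
proof -
  \<comment> \<open>Exponents \<open>d, ..., 1\<close> along \<open>s\<close>: pairing with them
    gives the double sum of partial sums, which only the weight \<open>Lam\<close>
    maximizes.\<close>
  define r where "r i = int d + 1 - int (inv_into {1..d} s i)" for i
  define r0 where "r0 = (\<Sum>j=1..d. \<Sum>a=1..j. Lam a)"
  have ev: "(\<Sum>i\<in>UNIV. r i * w i) = (\<Sum>j=1..d. \<Sum>a=1..j. w (s a))" for w
  proof -
    have "(\<Sum>i\<in>UNIV. r i * w i) = (\<Sum>a=1..d. r (s a) * w (s a))"
      by (rule sum.reindex_bij_betw[OF s, symmetric])
    also have "\<dots> = (\<Sum>a=1..d. (int d + 1 - int a) * w (s a))"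
      using bij_betw_inv_into_left[OF s] by (intro sum.cong) (auto simp: r_def)
    finally show ?thesis
      using sum_partial_sums[of "\<lambda>a. w (s a)" d] by simp
  qed
  obtain T where T: "\<And>f g. T (f + g) = T f + T g" "\<And>c f. T (\<lambda>x. c * f x) = (\<lambda>x. c * T f x)"
    "\<And>V f. csubspace V \<Longrightarrow> Kinvariant V \<Longrightarrow> f \<in> V \<Longrightarrow> T f \<in> V"
    "\<And>w f. w \<in> snd ` set xs \<Longrightarrow> f \<in> weight_space w \<Longrightarrow>
        T f = (if (\<Sum>a\<in>UNIV. r a * w a) = r0 then f else 0)"
    using torus_projection[of "snd ` set xs" r r0] by blast
  have T_iota: "T (iota (fst p)) = (\<lambda>x. fst p (mat 1) * iota f x)" if p: "p \<in> set xs" for p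
  proof -
    note ext = terms[OF p, unfolded extremal_term_def]
    have Tp: "T (iota (fst p)) = (if (\<Sum>a\<in>UNIV. r a * snd p a) = r0 then iota (fst p) else 0)"
      using p term_weight_space[OF p] by (intro T(4)) auto
    show ?thesis
    proof (cases "\<forall>a\<in>{1..d}. snd p (s a) = Lam a")
      case True
      then obtain c where c: "\<And>x. fst p x = c * f x"
        using ext by blast
      have "(\<Sum>j=1..d. \<Sum>a=1..j. snd p (s a)) = r0"
        unfolding r0_def using True by (intro sum.cong) auto
      then show ?thesis
        using Tp f_one by (auto simp: ev iota_def c fun_eq_iff)
    next
      case False
      then obtain a where "a \<in> {1..d}" "snd p (s a) \<noteq> Lam a"
        by blast
      moreover have "dominated d (\<lambda>a. snd p (s a)) Lam"
        using ext s by blast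
      ultimately have "(\<Sum>j=1..d. \<Sum>a=1..j. snd p (s a)) < r0"
        unfolding r0_def by (intro dominated_strict_sum)
      moreover have "fst p (mat 1) = 0"
        using False ext by blast
      ultimately show ?thesis
        using Tp by (auto simp: ev)
    qed
  qed
  have "T g = (\<lambda>x. g (mat 1) * iota f x)" if "g \<in> W" for g
    using that unfolding W_def
  proof (induction rule: cfun.span_induct_alt)
    case base
    then show ?case
      using T(2)[of 0 0] by (simp add: zero_fun_def)
  next
    case (step c h g)
    then obtain p where p: "p \<in> set xs" "h = iota (fst p)"
      by auto
    show ?case
      unfolding T(1) T(2) step.IH p(2) T_iota[OF p(1)]
      by (simp add: UK_one fun_eq_iff algebra_simps)
  qed
  with that[of T] T(3) show thesis
    by blast
qed

lemma irred_W: "irred_Ksubrep W"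
  unfolding irred_Ksubrep_def
proof (intro conjI allI impI)
  show "csubspace W"
    by (simp add: csubspace_iff subspace_W)
  show "Kinvariant W"
    by (rule Kinvariant_W)
  show "\<exists>B. finite B \<and> B \<subseteq> W \<and> W \<subseteq> cspan B"
    using cfun_span_finite_subset_cspan[of "iota ` fst ` set xs"]
    by (intro exI[of _ "iota ` fst ` set xs"]) (auto simp: W_def intro: cfun.span_base)
  have "Rtr (mat 1) (iota f) (mat 1) = 1"
    by (simp add: Rtr_def UK_one f_one)
  then show "\<exists>g\<in>W. g \<noteq> (\<lambda>x. 0)"
    using translate_mem_W[OF UK_one] by (intro bexI[of _ "Rtr (mat 1) (iota f)"]) auto
  fix V assume V: "csubspace V \<and> Kinvariant V \<and> V \<subseteq> W"
  show "V = {\<lambda>x. 0} \<or> V = W"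
  proof (cases "V \<subseteq> {\<lambda>x. 0}")
    case True
    then show ?thesis
      using V by (auto simp: csubspace_def)
  next
    case False
    then obtain g where "g \<in> V" "g \<noteq> (\<lambda>x. 0)"
      by blast
    then obtain y where y: "g y \<noteq> 0"
      by auto
    then have "y \<in> UK"
      using \<open>g \<in> V\<close> V W_off by blast
    \<comment> \<open>Translation by \<open>y\<close> moves the point where \<open>g\<close> is
      nonzero to the identity, where the projection formula evaluates.\<close>
    define h where "h = Rtr y g"
    have h: "h \<in> V" "h (mat 1) \<noteq> 0"
      using V \<open>g \<in> V\<close> \<open>y \<in> UK\<close> y by (auto simp: h_def Kinvariant_def Rtr_def UK_one)
    obtain T where T: "\<And>V g. csubspace V \<Longrightarrow> Kinvariant V \<Longrightarrow> g \<in> V \<Longrightarrow> T g \<in> V"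
      "\<And>g. g \<in> W \<Longrightarrow> T g = (\<lambda>x. g (mat 1) * iota f x)"
      using projection_onto_f by blast
    have "(\<lambda>x. h (mat 1) * iota f x) \<in> V"
      using T(1)[of V h] T(2)[of h] V h(1) by auto
    then have "iota f \<in> V"
      using cfun.subspace_scale[of V "\<lambda>x. h (mat 1) * iota f x" "inverse (h (mat 1))"] V h(2)
      by (simp add: csubspace_iff)
    then have "(\<lambda>k. Rtr k (iota f)) ` UK \<subseteq> V"
      using V by (auto simp: Kinvariant_def)
    then have "W \<subseteq> V"
      unfolding W_eq_span_translates using V by (intro cfun.span_minimal) (auto simp: csubspace_iff)
    then show ?thesis
      using V by auto
  qed
qed

text \<open>Expanding \<open>f\<close> at \<open>y = mat 1\<close> leaves only terms that do not
  vanish at the identity, and these all have the extremal weight.\<close>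

lemma right_weight:
  assumes "t \<in> TK"
  shows "f (x ** t) = (\<Prod>a=1..d. (t $ s a $ s a) powi Lam a) * f x"
proof -
  have f: "f x = (\<Sum>p\<leftarrow>xs. fst p x * cnj (fst p (mat 1)))" for x
    using expansion[of x "mat 1"] by simp
  have "fst p (x ** t) * cnj (fst p (mat 1))
      = (\<Prod>a=1..d. (t $ s a $ s a) powi Lam a) * (fst p x * cnj (fst p (mat 1)))"
    if p: "p \<in> set xs" for p
  proof (cases "fst p (mat 1) = 0")
    case False
    note ext = terms[OF p, unfolded extremal_term_def]
    have "chr (snd p) t = (\<Prod>a=1..d. (t $ s a $ s a) powi snd p (s a))"
      unfolding chr_def by (rule prod.reindex_bij_betw[OF s, symmetric])
    also have "\<dots> = (\<Prod>a=1..d. (t $ s a $ s a) powi Lam a)"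
      using ext False by (intro prod.cong) auto
    finally show ?thesis
      using ext assms by simp
  qed simp
  then have "(\<Sum>p\<leftarrow>xs. fst p (x ** t) * cnj (fst p (mat 1)))
      = (\<Sum>p\<leftarrow>xs. (\<Prod>a=1..d. (t $ s a $ s a) powi Lam a) * (fst p x * cnj (fst p (mat 1))))"
    by (intro arg_cong[of _ _ sum_list] map_cong) auto
  then show ?thesis
    unfolding f by (simp add: sum_list_const_mult)
qed

lemma is_weight_iff:
  assumes e: "bij_betw e {1..2*n} (UNIV :: 'm set)"
  shows "is_weight n e W mu \<longleftrightarrow> (\<exists>g\<in>W. g \<noteq> 0 \<and> g \<in> weight_space (mu \<circ> inv_into {1..2*n} e))"
proof -
  have "(\<Prod>a=1..2*n. chi (mu a) (ent e t a a)) = chr (mu \<circ> inv_into {1..2*n} e) t" if "t \<in> TK" for t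
  proof -
    have "chr (mu \<circ> inv_into {1..2*n} e) t
        = (\<Prod>a=1..2*n. (t $ e a $ e a) powi ((mu \<circ> inv_into {1..2*n} e) (e a)))"
      unfolding chr_def by (rule prod.reindex_bij_betw[OF e, symmetric])
    also have "\<dots> = (\<Prod>a=1..2*n. chi (mu a) (ent e t a a))"
      using bij_betw_inv_into_left[OF e]
      by (intro prod.cong) (simp_all add: ent_def chi_unit TK_norm[OF that])
    finally show ?thesis by simp
  qed
  then show ?thesis
    by (simp add: is_weight_def weight_space_def zero_fun_def)
qed

text \<open>The vector \<open>f\<close> has weight \<open>Lam\<close> along \<open>s\<close>;
  conjugating the torus by the permutation matrix that relates \<open>s\<close> and \<open>e\<close>
  turns its translate into a vector of weight \<open>Lam\<close> along \<open>e\<close>.\<close>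

lemma is_weight_W:
  assumes e: "bij_betw e {1..2*n} (UNIV :: 'm set)" and d: "d = 2 * n"
  shows "is_weight n e W Lam"
proof -
  obtain k where k: "k \<in> UK" and conj: "\<And>t. t \<in> TK \<Longrightarrow>
      \<exists>t'\<in>TK. t ** k = k ** t' \<and> (\<forall>a\<in>{1..2*n}. t' $ s a $ s a = t $ e a $ e a)"
    using permutation_conjugation[of s "2*n" e] s e d by blast
  define nu where "nu = Lam \<circ> inv_into {1..2*n} e"
  let ?g = "Rtr k (iota f)"
  have "?g (ctrans k) = 1"
    using UK_inverse[OF k] UK_ctrans[OF k] by (simp add: Rtr_def UK_one f_one)
  then have "?g \<noteq> 0"
    by auto
  moreover have "?g \<in> weight_space nu"
    unfolding weight_space_def
  proof safe
    fix t :: "complex^'m^'m" assume t: "t \<in> TK"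
    obtain t' where t': "t' \<in> TK" "t ** k = k ** t'" "\<forall>a\<in>{1..2*n}. t' $ s a $ s a = t $ e a $ e a"
      using conj[OF t] by blast
    have "chr nu t
        = (\<Prod>a=1..2*n. (t $ e a $ e a) powi nu (e a))"
      unfolding chr_def by (rule prod.reindex_bij_betw[OF e, symmetric])
    also have "\<dots> = (\<Prod>a=1..d. (t' $ s a $ s a) powi Lam a)"
      using bij_betw_inv_into_left[OF e] t'(3) d by (intro prod.cong) (auto simp: nu_def)
    finally have chr: "chr nu t = (\<Prod>a=1..d. (t' $ s a $ s a) powi Lam a)" .
    show "Rtr t ?g = (\<lambda>x. chr nu t * ?g x)"
    proof
      fix x
      have "f (x ** t ** k) = chr nu t * f (x ** k)"
        using right_weight[OF t'(1), of "x ** k"] t'(2) by (simp add: chr matrix_mul_assoc[symmetric])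
      then show "Rtr t ?g x = chr nu t * ?g x"
        using k TK_imp_UK[OF t] by (simp add: Rtr_def UK_mult)
    qed
  qed
  ultimately show ?thesis
    unfolding is_weight_iff[OF e] nu_def[symmetric] using translate_mem_W[OF k] by blast
qed

text \<open>Since the terms may be linearly dependent, a weight vector is compared with them through
  one partial sum at a time. If no term shared the \<open>j\<close>-th partial sum of
  \<open>mu\<close>, projecting onto that value would fix \<open>g\<close> and yet annihilate
  \<open>W\<close>. The term found may vary with \<open>j\<close>; dominance is a condition on each
  \<open>j\<close> separately.\<close>

lemma weight_dominated:
  assumes e: "bij_betw e {1..2*n} (UNIV :: 'm set)" and d: "d = 2 * n" and "is_weight n e W mu"
  shows "dominated (2*n) mu Lam"
proof -
  define nu where "nu = mu \<circ> inv_into {1..2*n} e"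
  obtain g where g: "g \<in> W" "g \<noteq> 0" "g \<in> weight_space nu"
    using assms(3) by (auto simp: is_weight_iff[OF e] nu_def)
  have partial: "\<exists>p\<in>set xs. (\<Sum>a=1..j. mu a) = (\<Sum>a=1..j. snd p (e a))" if j: "j \<le> 2*n" for j
  proof (rule ccontr)
    assume neq: "\<not> ?thesis"
    \<comment> \<open>The fundamental coweight of level \<open>j\<close>: its pairing with a weight
      is the \<open>j\<close>-th partial sum along \<open>e\<close>.\<close>
    define r where "r i = (if i \<in> e ` {1..j} then 1 else 0 :: int)" for i
    have inj: "inj_on e {1..2*n}"
      using e by (rule bij_betw_imp_inj_on)
    have ev: "(\<Sum>i\<in>UNIV. r i * w i) = (\<Sum>a=1..j. w (e a))" for w :: "'m \<Rightarrow> int"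
    proof -
      have "(\<Sum>i\<in>UNIV. r i * w i) = (\<Sum>i\<in>e ` {1..j}. w i)"
        by (rule sum.mono_neutral_cong_right) (auto simp: r_def)
      also have "\<dots> = (\<Sum>a=1..j. w (e a))"
        using inj_on_subset[OF inj, of "{1..j}"] j by (simp add: sum.reindex)
      finally show ?thesis .
    qed
    \<comment> \<open>The weight \<open>nu\<close> of \<open>g\<close> joins the filter, as it is
      not known to be the weight of a term.\<close>
    have fin: "finite (insert nu (snd ` set xs))"
      by simp
    obtain T where T: "\<And>f g. T (f + g) = T f + T g" "\<And>c f. T (\<lambda>x. c * f x) = (\<lambda>x. c * T f x)"
      "\<And>V f. csubspace V \<Longrightarrow> Kinvariant V \<Longrightarrow> f \<in> V \<Longrightarrow> T f \<in> V"
      "\<And>w f. w \<in> insert nu (snd ` set xs) \<Longrightarrow> f \<in> weight_space w \<Longrightarrow>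
          T f = (if (\<Sum>a\<in>UNIV. r a * w a) = (\<Sum>a=1..j. mu a) then f else 0)"
      using torus_projection[OF fin, of r "\<Sum>a=1..j. mu a"] by blast
    have "(\<Sum>a=1..j. nu (e a)) = (\<Sum>a=1..j. mu a)"
      using bij_betw_inv_into_left[OF e] j by (intro sum.cong) (auto simp: nu_def)
    then have "T g = g"
      using T(4)[of nu g] g(3) by (simp add: ev)
    moreover have "T g = 0"
      using g(1) unfolding W_def
    proof (induction rule: cfun.span_induct_alt)
      case base
      then show ?case
        using T(2)[of 0 0] by (simp add: zero_fun_def)
    next
      case (step c h g)
      then obtain p where p: "p \<in> set xs" "h = iota (fst p)"
        by auto
      have "T h = 0"
        using T(4)[of "snd p" h] p term_weight_space[OF p(1)] neq by (auto simp: ev)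
      then show ?case
        unfolding T(1) T(2) step.IH by (simp add: fun_eq_iff)
    qed
    ultimately show False
      using g(2) by simp
  qed
  have dom: "dominated (2*n) (\<lambda>a. snd p (e a)) Lam" if "p \<in> set xs" for p
    using terms[OF that] e d by (auto simp: extremal_term_def)
  have "(\<Sum>a=1..j. mu a) \<le> (\<Sum>a=1..j. Lam a)" if j: "j \<in> {1..2*n}" for j
  proof -
    obtain p where p: "p \<in> set xs" "(\<Sum>a=1..j. mu a) = (\<Sum>a=1..j. snd p (e a))"
      using partial[of j] j by auto
    then show ?thesis
      using dom[OF p(1)] j by (simp add: dominated_def)
  qed
  moreover have "(\<Sum>a=1..2*n. mu a) = (\<Sum>a=1..2*n. Lam a)"
  proof -
    obtain p where p: "p \<in> set xs" "(\<Sum>a=1..2*n. mu a) = (\<Sum>a=1..2*n. snd p (e a))"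
      using partial[of "2*n"] by auto
    then show ?thesis
      using dom[OF p(1)] by (simp add: dominated_def)
  qed
  ultimately show ?thesis
    by (simp add: dominated_def)
qed

end

text \<open>The two torus actions are read along different enumerations: the left law along
  \<open>s\<close>, where \<open>char\<close> identifies it with the one defining
  \<open>piK\<close>, and the right weights along \<open>e\<close>.\<close>

lemma extremal_kernel_constituent:
  fixes s e :: "nat \<Rightarrow> 'm::finite"
  assumes s: "bij_betw s {1..2*n} UNIV" and e: "bij_betw e {1..2*n} UNIV"
    and kernel: "extremal_kernel s (2*n) Lam f F"
    and char: "\<And>t. t \<in> TK \<Longrightarrow> (\<Prod>a=1..2*n. (t $ s a $ s a) powi Lam a)
      = (\<Prod>i=1..n. chi (N i + L) (ent e t (2*i-1) (2*i-1)) * chi (- N i + L) (ent e t (2*i) (2*i)))"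
  obtains W where "constituent_hw n e N L Lam W" "iota F \<in> W"
proof -
  obtain xs where xs: "\<And>x y. f (x ** ctrans y) = (\<Sum>p\<leftarrow>xs. fst p x * cnj (fst p y))"
    "\<forall>p\<in>set xs. extremal_term s (2*n) Lam f (fst p) (snd p)" "F \<in> cfun.span (fst ` set xs)"
    using kernel by (auto simp: extremal_kernel_def)
  interpret K: kernel_expansion s "2*n" Lam f xs
    using s xs kernel by unfold_locales (auto simp: extremal_kernel_def)
  have "K.W \<subseteq> piK n e N L"
  proof
    fix g assume g: "g \<in> K.W"
    then show "g \<in> piK n e N L"
      unfolding piK_def using K.W_smooth[OF g] K.W_off[OF g] K.W_left[OF g]
      by (simp only: mem_Collect_eq char) blast
  qed
  then have "constituent_hw n e N L Lam K.W"
    unfolding constituent_hw_def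
    using K.irred_W K.is_weight_W[OF e refl] K.weight_dominated[OF e refl] by blast
  moreover have "iota F \<in> K.W"
    unfolding K.W_def by (rule iota_span[OF xs(3)])
  ultimately show thesis
    by (rule that)
qed

section \<open>Minors as extremal kernels\<close>

lemma extremal_term_scale:
  assumes "extremal_term s d Lam f m w"
  shows "extremal_term s d Lam f (\<lambda>x. c * m x) w"
  unfolding extremal_term_def
proof (intro conjI ballI allI impI)
  show "poly_fun (\<lambda>x. c * m x)"
    using assms by (auto simp: extremal_term_def intro: poly_fun.intros)
  show "w (s a) = Lam a" if "c * m (mat 1) \<noteq> 0" "a \<in> {1..d}" for a
    using assms that by (auto simp: extremal_term_def)
  show "\<exists>c'. \<forall>x. c * m x = c' * f x" if eq: "\<forall>a\<in>{1..d}. w (s a) = Lam a"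
  proof -
    obtain c' where "\<forall>x. m x = c' * f x"
      using assms eq by (auto simp: extremal_term_def)
    then show ?thesis
      by (intro exI[of _ "c * c'"]) simp
  qed
qed (use assms in \<open>auto simp: extremal_term_def\<close>)

text \<open>A positive constant in front of the kernel is shared as \<open>sqrt c\<close> between
  the two arguments, which leaves the unit coefficients required of an expansion; rescaled terms
  have the same span.\<close>

lemma extremal_kernelI:
  assumes fin: "finite G" and "c > 0"
    and exp: "\<And>x y. f (x ** ctrans y) = of_real c * (\<Sum>g\<in>G. m g x * cnj (m g y))"
    and ext: "\<And>g. g \<in> G \<Longrightarrow> extremal_term s d Lam f (m g) (w g)"
    and "f (mat 1) = 1"
    and "\<And>t x. t \<in> TK \<Longrightarrow> f (t ** x) = (\<Prod>a=1..d. (t $ s a $ s a) powi Lam a) * f x"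
    and F: "F \<in> cfun.span (m ` G)"
  shows "extremal_kernel s d Lam f F"
proof -
  obtain gs where gs: "set gs = G" "distinct gs"
    using finite_distinct_list[OF fin] by blast
  define xs where "xs = map (\<lambda>g. ((\<lambda>x. of_real (sqrt c) * m g x), w g)) gs"
  have c: "of_real (sqrt c) * of_real (sqrt c) = (of_real c :: complex)"
    using \<open>c > 0\<close> by (simp flip: of_real_mult)
  have "f (x ** ctrans y) = (\<Sum>p\<leftarrow>xs. fst p x * cnj (fst p y))" for x y
  proof -
    have "(\<Sum>p\<leftarrow>xs. fst p x * cnj (fst p y))
        = (\<Sum>g\<in>G. (of_real (sqrt c) * m g x) * cnj (of_real (sqrt c) * m g y))"
      using gs by (simp only: xs_def map_map o_def fst_conv sum_list_distinct_conv_sum_set)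
    also have "\<dots> = (\<Sum>g\<in>G. (of_real (sqrt c) * of_real (sqrt c)) * (m g x * cnj (m g y)))"
      by (intro sum.cong) (simp_all only: complex_cnj_mult complex_cnj_complex_of_real mult_ac)
    finally show ?thesis
      unfolding c exp sum_distrib_left by simp
  qed
  moreover have "extremal_term s d Lam f (fst p) (snd p)" if "p \<in> set xs" for p
    using that gs ext by (auto simp: xs_def intro!: extremal_term_scale)
  moreover have "m ` G \<subseteq> cfun.span (fst ` set xs)"
  proof safe
    fix g assume "g \<in> G"
    then have "(\<lambda>x. of_real (sqrt c) * m g x) \<in> cfun.span (fst ` set xs)"
      using gs by (intro cfun.span_base) (auto simp: xs_def image_image)
    from cfun.span_scale[OF this, of "inverse (of_real (sqrt c))"]
    show "m g \<in> cfun.span (fst ` set xs)"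
      using \<open>c > 0\<close> by (simp add: mult.assoc[symmetric])
  qed
  then have "F \<in> cfun.span (fst ` set xs)"
    using F cfun.span_minimal[OF _ cfun.subspace_span] by blast
  ultimately show ?thesis
    using assms(5,6) unfolding extremal_kernel_def by blast
qed

lemma dominated_cong:
  "(\<And>a. a \<in> {1..d} \<Longrightarrow> A a = B a) \<Longrightarrow> dominated d u A = dominated d u B"
  unfolding dominated_def by (intro arg_cong2[where f = "(\<and>)"] ball_cong refl arg_cong2[where f = "(\<le>)"]
      arg_cong2[where f = "(=)"] sum.cong) auto

lemma extremal_kernel_cong:
  assumes "extremal_kernel s d A f F" and eq: "\<And>a. a \<in> {1..d} \<Longrightarrow> A a = B a"
  shows "extremal_kernel s d B f F"
proof -
  have ext: "extremal_term s d A f m w = extremal_term s d B f m w" for m w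
    unfolding extremal_term_def using dominated_cong[of d A B] eq by simp
  have left: "(\<Prod>a=1..d. (t $ s a $ s a) powi A a) = (\<Prod>a=1..d. (t $ s a $ s a) powi B a)"
    for t :: "complex^'a^'a"
    using eq by (intro prod.cong) auto
  show ?thesis
    using assms(1) unfolding extremal_kernel_def ext left .
qed

section \<open>Minors, their torus weights and their values at the identity\<close>

definition minor :: "nat \<Rightarrow> (nat \<Rightarrow> 'm) \<Rightarrow> (nat \<Rightarrow> 'm) \<Rightarrow> complex^'m::finite^'m \<Rightarrow> complex" where
  "minor k r g x = det_on {1..k} (\<lambda>i j. x $ r i $ g j)"

lemma minor_cong: "(\<And>i. i \<in> {1..k} \<Longrightarrow> r i = r' i) \<Longrightarrow> (\<And>i. i \<in> {1..k} \<Longrightarrow> g i = g' i)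
    \<Longrightarrow> minor k r g = minor k r' g'"
  unfolding minor_def by (intro ext det_on_cong) auto

text \<open>Cauchy-Binet for a product with an adjoint: after a transposition the second minor is
  the conjugate of one of the same form. The constant compensates for the orderings of each column
  set.\<close>

lemma minor_kernel:
  "minor k r r (x ** ctrans y) = of_real (1 / fact k)
    * (\<Sum>g\<in>inj_funs {1..k} UNIV. minor k r g x * cnj (minor k r g y))"
proof -
  have "minor k r r (x ** ctrans y) = det_on {1..k} (\<lambda>i j. \<Sum>c\<in>UNIV. x $ r i $ c * cnj (y $ r j $ c))"
    by (simp add: minor_def matrix_mult_nth)
  moreover have "det_on {1..k} (\<lambda>i j. cnj (y $ r j $ g i)) = cnj (minor k r g y)" for g
    unfolding minor_def det_on_cnj by (rule det_on_transpose) simp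
  ultimately have "fact k * minor k r r (x ** ctrans y)
      = (\<Sum>g\<in>inj_funs {1..k} UNIV. minor k r g x * cnj (minor k r g y))"
    using Cauchy_Binet[of "{1..k}" UNIV "\<lambda>i c. x $ r i $ c" "\<lambda>c j. cnj (y $ r j $ c)"]
    by (simp add: minor_def)
  then show ?thesis
    by (simp add: field_simps)
qed

definition ind :: "'m set \<Rightarrow> 'm \<Rightarrow> int" where
  "ind R a = (if a \<in> R then 1 else 0)"

lemma chr_ind: "chr (ind R) t = (\<Prod>a\<in>R. t $ a $ a)"
  unfolding chr_def by (rule prod.mono_neutral_cong_right) (auto simp: ind_def)

lemma TK_cnj: "t \<in> TK \<Longrightarrow> cnj (t $ a $ a) = inverse (t $ a $ a)"
  using inverse_unique[of "t $ a $ a" "cnj (t $ a $ a)"] TK_norm[of t a]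
  by (simp add: complex_norm_square[symmetric])

lemma chr_uminus:
  assumes "t \<in> TK"
  shows "chr (\<lambda>a. - w a) t = cnj (chr w t)"
  by (simp add: chr_def power_int_minus power_int_inverse TK_cnj[OF assms])

lemma minor_right:
  assumes t: "t \<in> TK" and g: "inj_on g {1..k}"
  shows "minor k r g (x ** t) = chr (ind (g ` {1..k})) t * minor k r g x"
  unfolding minor_def TK_mult_right[OF t] chr_ind using g
  by (simp add: det_on_scale_columns prod.reindex)

lemma minor_left:
  assumes t: "t \<in> TK"
  shows "minor k r g (t ** x) = (\<Prod>i=1..k. t $ r i $ r i) * minor k r g x"
  unfolding minor_def TK_mult_left[OF t] by (rule det_on_scale_rows)

lemma minor_one: "inj_on r {1..k} \<Longrightarrow> minor k r r (mat 1) = 1"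
  unfolding minor_def mat_def
  using det_on_cong[of "{1..k}" "\<lambda>i j. (\<chi> i j. if i = j then 1 else 0) $ r i $ r j" "\<lambda>i j. if i = j then 1 else 0"]
  by (simp add: det_on_identity inj_on_eq_iff)

text \<open>A row index missing among the columns gives a zero row in the identity matrix. So every
  row index occurs as a column, and counting gives equality.\<close>

lemma minor_one_nonzero:
  assumes r: "inj_on r {1..k}" and nz: "minor k r g (mat 1) \<noteq> 0"
  shows "g ` {1..k} = r ` {1..k}"
proof -
  have "r i \<in> g ` {1..k}" if "i \<in> {1..k}" for i
  proof (rule ccontr)
    assume "r i \<notin> g ` {1..k}"
    then have "minor k r g (mat 1) = 0"
      unfolding minor_def using that by (intro det_on_zero_row[of _ i]) (auto simp: mat_def)
    with nz show False ..
  qed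
  then have "r ` {1..k} \<subseteq> g ` {1..k}"
    by auto
  moreover have "card (g ` {1..k}) \<le> card (r ` {1..k})"
    using card_image_le[of "{1..k}" g] card_image[OF r] by simp
  ultimately show ?thesis
    using card_seteq[of "g ` {1..k}" "r ` {1..k}"] by simp
qed

text \<open>The two column sequences differ by a permutation of positions, and \<open>c\<close> is
  its sign.\<close>

lemma minor_same_columns:
  assumes r: "inj_on r {1..k}" and g: "inj_on g {1..k}" and eq: "g ` {1..k} = r ` {1..k}"
  shows "\<exists>c. \<forall>x. minor k r g x = of_int c * minor k r r x"
proof -
  define p where "p j = (if j \<in> {1..k} then inv_into {1..k} r (g j) else j)" for j
  have "bij_betw (inv_into {1..k} r \<circ> g) {1..k} {1..k}"
    using bij_betw_trans[OF bij_betw_imageI[OF g refl], of "inv_into {1..k} r" "{1..k}"]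
      bij_betw_inv_into[OF bij_betw_imageI[OF r refl]] eq by simp
  then have "bij_betw p {1..k} {1..k}"
    by (rule bij_betw_cong[THEN iffD1, rotated]) (simp add: p_def)
  then have p: "p permutes {1..k}"
    by (rule bij_imp_permutes) (auto simp: p_def)
  have "r (p j) = g j" if j: "j \<in> {1..k}" for j
  proof -
    have "g j \<in> r ` {1..k}"
      using j eq by blast
    then show ?thesis
      using j unfolding p_def by (simp only: if_True f_inv_into_f)
  qed
  then have "minor k r g x = det_on {1..k} (\<lambda>i j. x $ r i $ r (p j))" for x
    unfolding minor_def by (intro det_on_cong) auto
  then show ?thesis
    using det_on_permute_columns[OF p, of "\<lambda>i j. _ $ r i $ r j"] by (auto simp: minor_def)
qed

lemma poly_fun_minor: "poly_fun (minor k r g)"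
  unfolding minor_def by (intro poly_fun_det_on poly_fun.entry)

lemma poly_fun_cnj_minor: "poly_fun (\<lambda>x. cnj (minor k r g x))"
  unfolding minor_def det_on_cnj by (intro poly_fun_det_on poly_fun.cnj_entry)

lemma surj_set_eqI:
  assumes s: "bij_betw s A UNIV" and eq: "\<And>a. a \<in> A \<Longrightarrow> s a \<in> P \<longleftrightarrow> s a \<in> Q"
  shows "P = Q"
proof (rule set_eqI)
  fix b
  have "b \<in> s ` A"
    using bij_betw_imp_surj_on[OF s] by simp
  then show "b \<in> P \<longleftrightarrow> b \<in> Q"
    using eq by auto
qed

section \<open>Dominance for weights of minors\<close>

lemma sum_ind:
  fixes j :: nat
  shows "(\<Sum>a=1..j. ind R (r a)) = int (card {a\<in>{1..j}. r a \<in> R})"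
  unfolding ind_def using sum.inter_filter[OF finite_atLeastAtMost, of "\<lambda>_. 1 :: int" 1 j "\<lambda>a. r a \<in> R"] by simp

text \<open>The first \<open>j\<close> places hold at most \<open>j\<close> elements of
  \<open>R\<close>, the other places at most \<open>d - j\<close>. The upper estimate serves minors,
  the lower one conjugated minors.\<close>

lemma card_hits:
  assumes r: "bij_betw r {1..d} (UNIV :: 'm::finite set)" and j: "j \<le> d"
  shows "card {a\<in>{1..d}. r a \<in> R} = card R"
    and "card {a\<in>{1..j}. r a \<in> R} \<le> min j (card R)"
    and "card R \<le> card {a\<in>{1..j}. r a \<in> R} + (d - j)"
proof -
  have "bij_betw r {a\<in>{1..d}. r a \<in> R} R"
  proof (rule bij_betw_imageI)
    show "inj_on r {a\<in>{1..d}. r a \<in> R}"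
      using bij_betw_imp_inj_on[OF r] by (rule inj_on_subset) auto
    have "r ` {a\<in>{1..d}. r a \<in> R} = r ` {1..d} \<inter> R"
      by auto
    then show "r ` {a\<in>{1..d}. r a \<in> R} = R"
      using bij_betw_imp_surj_on[OF r] by simp
  qed
  then show d: "card {a\<in>{1..d}. r a \<in> R} = card R"
    by (rule bij_betw_same_card)
  have "card {a\<in>{1..j}. r a \<in> R} \<le> card {1..j}"
    by (intro card_mono) auto
  moreover have "card {a\<in>{1..j}. r a \<in> R} \<le> card {a\<in>{1..d}. r a \<in> R}"
    using j by (intro card_mono) auto
  ultimately show "card {a\<in>{1..j}. r a \<in> R} \<le> min j (card R)"
    using d by simp
  have "card {a\<in>{1..d}. r a \<in> R} \<le> card ({a\<in>{1..j}. r a \<in> R} \<union> {j+1..d})"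
    by (intro card_mono) auto
  also have "\<dots> \<le> card {a\<in>{1..j}. r a \<in> R} + card {j+1..d}"
    by (rule card_Un_le)
  finally show "card R \<le> card {a\<in>{1..j}. r a \<in> R} + (d - j)"
    using d by simp
qed

text \<open>Partial sums of a 0-1 sequence with \<open>k\<close> ones are largest when the ones come
  first; the extremal case is a fundamental weight.\<close>

lemma dominated_ind:
  assumes r: "bij_betw r {1..d} (UNIV :: 'm::finite set)" and "card R = k" "k \<le> d"
  shows "dominated d (\<lambda>a. ind R (r a)) (\<lambda>a. if a \<le> k then 1 else 0)"
proof -
  have "(\<Sum>a=1..j. if a \<le> k then 1 else 0 :: int) = int (min j k)" for j
    by (induction j) auto
  moreover have "int (card {a\<in>{1..j}. r a \<in> R}) \<le> int (min j k)" if "j \<in> {1..d}" for j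
    using card_hits(2)[OF r, of j R] that assms(2) by simp
  moreover have "int (card {a\<in>{1..d}. r a \<in> R}) = int (min d k)"
    using card_hits(1)[OF r order_refl, of R] assms(2,3) by simp
  ultimately show ?thesis
    unfolding dominated_def sum_ind by simp
qed

text \<open>With entries -1 the partial sums are largest when these entries come last, which is why
  conjugated minors go with final rows.\<close>

lemma dominated_uminus_ind:
  assumes r: "bij_betw r {1..d} (UNIV :: 'm::finite set)" and "card R = k" "k \<le> d"
  shows "dominated d (\<lambda>a. - ind R (r a)) (\<lambda>a. if a > d - k then - 1 else 0)"
proof -
  have "(\<Sum>a=1..j. if a > d - k then - 1 else 0 :: int) = - int (j - (d - k))" for j
    by (induction j) auto
  moreover have "- int (card {a\<in>{1..j}. r a \<in> R}) \<le> - int (j - (d - k))" if "j \<in> {1..d}" for j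
  proof -
    have "k \<le> card {a\<in>{1..j}. r a \<in> R} + (d - j)"
      using card_hits(3)[OF r, of j R] that assms(2) by simp
    then have "j - (d - k) \<le> card {a\<in>{1..j}. r a \<in> R}"
      using that assms(3) unfolding atLeastAtMost_iff by linarith
    then show ?thesis
      by simp
  qed
  moreover have "- int (card {a\<in>{1..d}. r a \<in> R}) = - int (d - (d - k))"
    using card_hits(1)[OF r order_refl, of R] assms(2,3) by simp
  ultimately show ?thesis
    unfolding dominated_def sum_negf sum_ind by simp
qed

lemma inj_on_initial:
  "bij_betw s {1..d} (UNIV :: 'm set) \<Longrightarrow> k \<le> d \<Longrightarrow> inj_on s {1..k}" for d :: nat
  by (rule inj_on_subset[OF bij_betw_imp_inj_on]) auto

lemma inj_on_final:
  fixes d :: nat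
  assumes "bij_betw s {1..d} (UNIV :: 'm set)" and "k \<le> d"
  shows "inj_on (\<lambda>i. s (d + 1 - i)) {1..k}"
proof (rule inj_onI)
  fix i j assume ij: "i \<in> {1..k}" "j \<in> {1..k}" "s (d + 1 - i) = s (d + 1 - j)"
  then have "d + 1 - i = d + 1 - j"
    using assms(2) by (intro inj_onD[OF bij_betw_imp_inj_on[OF assms(1)] ij(3)]) auto
  then show "i = j"
    using ij(1,2) assms(2) by auto
qed

text \<open>The weight of a minor remembers its column set. The extremal weight therefore forces the
  columns \<open>s 1, ..., s k\<close> up to order, and the minor is the principal one up to
  sign.\<close>

lemma extremal_term_minor:
  assumes s: "bij_betw s {1..d} (UNIV :: 'm::finite set)" and k: "k \<le> d" and g: "inj_on g {1..k}"
  shows "extremal_term s d (\<lambda>a. if a \<le> k then 1 else 0) (minor k s s) (minor k s g) (ind (g ` {1..k}))"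
proof -
  have inj: "inj_on s {1..k}"
    by (rule inj_on_initial[OF s k])
  have "card (g ` {1..k}) = k"
    using card_image[OF g] by simp
  note dom = dominated_ind[OF _ this k]
  have iff: "s a \<in> s ` {1..k} \<longleftrightarrow> a \<le> k" if "a \<in> {1..d}" for a
    using inj_on_image_mem_iff[OF bij_betw_imp_inj_on[OF s] that, of "{1..k}"] that k by auto
  show ?thesis
    unfolding extremal_term_def
  proof (intro conjI ballI allI impI)
    fix a assume "minor k s g (mat 1) \<noteq> 0" "a \<in> {1..d}"
    then show "ind (g ` {1..k}) (s a) = (if a \<le> k then 1 else 0)"
      using minor_one_nonzero[OF inj] iff by (simp add: ind_def)
  next
    assume *: "\<forall>a\<in>{1..d}. ind (g ` {1..k}) (s a) = (if a \<le> k then 1 else 0)"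
    have "s a \<in> g ` {1..k} \<longleftrightarrow> s a \<in> s ` {1..k}" if "a \<in> {1..d}" for a
      using *[rule_format, OF that] iff[OF that] by (auto simp: ind_def split: if_splits)
    then have "g ` {1..k} = s ` {1..k}"
      by (rule surj_set_eqI[OF s])
    then show "\<exists>c. \<forall>x. minor k s g x = c * minor k s s x"
      using minor_same_columns[OF inj g] by blast
  qed (rule dom poly_fun_minor minor_right[OF _ g]; assumption?)+
qed

lemma extremal_term_cnj_minor:
  fixes s :: "nat \<Rightarrow> 'm::finite" and d :: nat
  defines "r \<equiv> \<lambda>i. s (d + 1 - i)"
  assumes s: "bij_betw s {1..d} (UNIV :: 'm set)" and k: "k \<le> d" and g: "inj_on g {1..k}"
  shows "extremal_term s d (\<lambda>a. if a > d - k then - 1 else 0) (\<lambda>x. cnj (minor k r r x))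
    (\<lambda>x. cnj (minor k r g x)) (\<lambda>a. - ind (g ` {1..k}) a)" (is "extremal_term s d ?Lam _ _ _")
proof -
  have inj: "inj_on r {1..k}"
    unfolding r_def by (rule inj_on_final[OF s k])
  have "card (g ` {1..k}) = k"
    using card_image[OF g] by simp
  note dom = dominated_uminus_ind[OF _ this k]
  have r_image: "r ` {1..k} = s ` {d - k + 1..d}"
  proof -
    have "r ` {1..k} = s ` ((\<lambda>i. d + 1 - i) ` {1..k})"
      by (simp add: r_def image_image)
    also have "(\<lambda>i. d + 1 - i) ` {1..k} = {d - k + 1..d}"
    proof safe
      fix b assume "b \<in> {d - k + 1..d}"
      then show "b \<in> (\<lambda>i. d + 1 - i) ` {1..k}"
        using k by (intro image_eqI[of _ _ "d + 1 - b"]) auto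
    qed (use k in auto)
    finally show ?thesis .
  qed
  have iff: "s a \<in> r ` {1..k} \<longleftrightarrow> a > d - k" if "a \<in> {1..d}" for a
    unfolding r_image
    using inj_on_image_mem_iff[OF bij_betw_imp_inj_on[OF s] that, of "{d - k + 1..d}"] that by auto
  show ?thesis
    unfolding extremal_term_def
  proof (intro conjI ballI allI impI)
    fix a assume "cnj (minor k r g (mat 1)) \<noteq> 0" "a \<in> {1..d}"
    then show "- ind (g ` {1..k}) (s a) = ?Lam a"
      using minor_one_nonzero[OF inj] iff by (simp add: ind_def)
  next
    assume *: "\<forall>a\<in>{1..d}. - ind (g ` {1..k}) (s a) = ?Lam a"
    have "s a \<in> g ` {1..k} \<longleftrightarrow> s a \<in> r ` {1..k}" if "a \<in> {1..d}" for a
      using *[rule_format, OF that] iff[OF that] by (auto simp: ind_def split: if_splits)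
    then have "g ` {1..k} = r ` {1..k}"
      by (rule surj_set_eqI[OF s])
    then obtain c where "\<forall>x. minor k r g x = of_int c * minor k r r x"
      using minor_same_columns[OF inj g] by blast
    then show "\<exists>c. \<forall>x. cnj (minor k r g x) = c * cnj (minor k r r x)"
      by (intro exI[of _ "of_int c"]) simp
  next
    show "cnj (minor k r g (x ** t)) = chr (\<lambda>a. - ind (g ` {1..k}) a) t * cnj (minor k r g x)"
      if "t \<in> TK" for t x
      using that by (simp add: minor_right[OF _ g] chr_uminus)
  qed (rule dom poly_fun_cnj_minor; assumption?)+
qed

lemma minor_left_weight:
  assumes s: "bij_betw s {1..d} (UNIV :: 'm::finite set)" and k: "k \<le> d" and t: "t \<in> TK"
  shows "minor k s s (t ** x)
    = (\<Prod>a=1..d. (t $ s a $ s a) powi (if a \<le> k then 1 else 0)) * minor k s s x"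
proof -
  have "(\<Prod>a=1..d. (t $ s a $ s a) powi (if a \<le> k then 1 else 0)) = (\<Prod>a=1..k. t $ s a $ s a)"
    using k by (intro prod.mono_neutral_cong_right) auto
  then show ?thesis
    by (simp add: minor_left[OF t])
qed

lemma cnj_minor_left_weight:
  fixes s :: "nat \<Rightarrow> 'm::finite" and d :: nat
  defines "r \<equiv> \<lambda>i. s (d + 1 - i)"
  assumes s: "bij_betw s {1..d} (UNIV :: 'm::finite set)" and k: "k \<le> d" and t: "t \<in> TK"
  shows "cnj (minor k r r (t ** x))
    = (\<Prod>a=1..d. (t $ s a $ s a) powi (if a > d - k then - 1 else 0)) * cnj (minor k r r x)"
proof -
  have "(\<Prod>a=1..d. (t $ s a $ s a) powi (if a > d - k then - 1 else 0))
      = (\<Prod>a=d - k + 1..d. cnj (t $ s a $ s a))"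
    by (intro prod.mono_neutral_cong_right) (auto simp: TK_cnj[OF t] power_int_minus)
  also have "\<dots> = (\<Prod>i=1..k. cnj (t $ r i $ r i))"
    unfolding r_def using k
    by (intro prod.reindex_bij_witness[of _ "\<lambda>i. d + 1 - i" "\<lambda>i. d + 1 - i"]) auto
  finally show ?thesis
    by (simp add: minor_left[OF t])
qed

lemma extremal_kernel_minor:
  assumes s: "bij_betw s {1..d} (UNIV :: 'm::finite set)" and k: "k \<le> d" and g: "inj_on g {1..k}"
  shows "extremal_kernel s d (\<lambda>a. if a \<le> k then 1 else 0) (minor k s s) (minor k s g)"
proof (rule extremal_kernelI[where G = "inj_funs {1..k} UNIV" and c = "1 / fact k"
      and m = "minor k s" and w = "\<lambda>g. ind (g ` {1..k})"])
  show "extremal_term s d (\<lambda>a. if a \<le> k then 1 else 0) (minor k s s) (minor k s h) (ind (h ` {1..k}))"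
    if "h \<in> inj_funs {1..k} UNIV" for h
    using that extremal_term_minor[OF s k] by (simp add: inj_funs_def)
  show "minor k s s (mat 1) = 1"
    by (rule minor_one[OF inj_on_initial[OF s k]])
  \<comment> \<open>Members of \<open>inj_funs\<close> are extensional, so \<open>g\<close> is cut
    down to \<open>{1..k}\<close> first.\<close>
  have "minor k s g = minor k s (restrict g {1..k})"
    by (rule minor_cong) auto
  then show "minor k s g \<in> cfun.span (minor k s ` inj_funs {1..k} UNIV)"
    using g by (auto simp: inj_funs_def inj_on_restrict_eq intro!: cfun.span_base)
qed (simp_all add: minor_kernel minor_left_weight[OF s k] finite_inj_funs)

lemma extremal_kernel_cnj_minor:
  fixes s :: "nat \<Rightarrow> 'm::finite" and d :: nat
  defines "r \<equiv> \<lambda>i. s (d + 1 - i)"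
  assumes s: "bij_betw s {1..d} (UNIV :: 'm set)" and k: "k \<le> d" and g: "inj_on g {1..k}"
  shows "extremal_kernel s d (\<lambda>a. if a > d - k then - 1 else 0) (\<lambda>x. cnj (minor k r r x))
    (\<lambda>x. cnj (minor k r g x))"
proof (rule extremal_kernelI[where G = "inj_funs {1..k} UNIV" and c = "1 / fact k"
      and m = "\<lambda>g x. cnj (minor k r g x)" and w = "\<lambda>g a. - ind (g ` {1..k}) a"])
  show "extremal_term s d (\<lambda>a. if a > d - k then - 1 else 0) (\<lambda>x. cnj (minor k r r x))
      (\<lambda>x. cnj (minor k r h x)) (\<lambda>a. - ind (h ` {1..k}) a)"
    if "h \<in> inj_funs {1..k} UNIV" for h
    unfolding r_def using that by (intro extremal_term_cnj_minor[OF s k]) (simp add: inj_funs_def)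
  show "cnj (minor k r r (mat 1)) = 1"
    using minor_one[OF inj_on_final[OF s k]] by (simp only: r_def complex_cnj_one)
  have "minor k r g = minor k r (restrict g {1..k})"
    by (rule minor_cong) auto
  then show "(\<lambda>x. cnj (minor k r g x)) \<in> cfun.span ((\<lambda>g x. cnj (minor k r g x)) ` inj_funs {1..k} UNIV)"
    using g by (auto simp: inj_funs_def inj_on_restrict_eq intro!: cfun.span_base)
qed (simp_all add: minor_kernel cnj_minor_left_weight[OF s k, folded r_def] finite_inj_funs)

text \<open>The product rule for kernels only reaches products of one function from each span, while
  \<open>F\<close> may be a sum that correlates the two minors, as in the Cauchy-Binet expansion of
  \<open>Fk\<close>. So the expansion over pairs is built directly.\<close>

lemma extremal_kernel_minor_pair:
  fixes s :: "nat \<Rightarrow> 'm::finite" and d :: nat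
  defines "r \<equiv> \<lambda>i. s (d + 1 - i)"
  assumes s: "bij_betw s {1..d} (UNIV :: 'm set)" and k: "k \<le> d"
    and F: "F \<in> cfun.span ((\<lambda>(g, h) x. minor k s g x * cnj (minor k r h x))
        ` (inj_funs {1..k} UNIV \<times> inj_funs {1..k} UNIV))"
  shows "extremal_kernel s d (\<lambda>a. (if a \<le> k then 1 else 0) + (if a > d - k then - 1 else 0))
    (\<lambda>x. minor k s s x * cnj (minor k r r x)) F"
proof (rule extremal_kernelI[OF _ _ _ _ _ _ F, where c = "1 / fact k * (1 / fact k)"
      and w = "\<lambda>(g, h) a. ind (g ` {1..k}) a + - ind (h ` {1..k}) a"])
  let ?G = "inj_funs {1..k} (UNIV :: 'm set)"
  show "extremal_term s d (\<lambda>a. (if a \<le> k then 1 else 0) + (if a > d - k then - 1 else 0))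
      (\<lambda>x. minor k s s x * cnj (minor k r r x))
      ((\<lambda>(g, h) x. minor k s g x * cnj (minor k r h x)) p)
      ((\<lambda>(g, h) a. ind (g ` {1..k}) a + - ind (h ` {1..k}) a) p)"
    if p_mem: "p \<in> ?G \<times> ?G" for p
  proof -
    obtain g h where p: "p = (g, h)" and gh: "inj_on g {1..k}" "inj_on h {1..k}"
      using p_mem unfolding inj_funs_def by blast
    show ?thesis
      unfolding p prod.case r_def
      by (rule extremal_term_mult[OF s extremal_term_minor[OF s k gh(1)]
            extremal_term_cnj_minor[OF s k gh(2)]])
  qed
  show "minor k s s (x ** ctrans y) * cnj (minor k r r (x ** ctrans y))
      = of_real (1 / fact k * (1 / fact k)) * (\<Sum>p\<in>?G \<times> ?G.
        ((\<lambda>(g, h) x. minor k s g x * cnj (minor k r h x)) p) x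
        * cnj (((\<lambda>(g, h) x. minor k s g x * cnj (minor k r h x)) p) y))" for x y
  proof -
    have "(\<Sum>p\<in>?G \<times> ?G. ((\<lambda>(g, h) x. minor k s g x * cnj (minor k r h x)) p) x
        * cnj (((\<lambda>(g, h) x. minor k s g x * cnj (minor k r h x)) p) y))
      = (\<Sum>g\<in>?G. minor k s g x * cnj (minor k s g y)) * (\<Sum>h\<in>?G. cnj (minor k r h x) * minor k r h y)"
      unfolding sum_product sum.cartesian_product by (intro sum.cong) (auto simp: mult_ac)
    then show ?thesis
      by (simp add: minor_kernel)
  qed
  show "minor k s s (mat 1) * cnj (minor k r r (mat 1)) = 1"
    using minor_one[OF inj_on_initial[OF s k]] minor_one[OF inj_on_final[OF s k]]
    by (simp only: r_def complex_cnj_one mult_1)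
  show "minor k s s (t ** x) * cnj (minor k r r (t ** x))
      = (\<Prod>a=1..d. (t $ s a $ s a) powi ((if a \<le> k then 1 else 0) + (if a > d - k then - 1 else 0)))
        * (minor k s s x * cnj (minor k r r x))" if t: "t \<in> TK" for t x
    unfolding minor_left_weight[OF s k t] cnj_minor_left_weight[OF s k t, folded r_def]
    by (simp only: power_int_add[OF disjI1[OF TK_nz[OF t]]] prod.distrib mult_ac)
qed (simp_all add: finite_inj_funs)

section \<open>The determinant and its conjugate as kernels with a single term\<close>

lemma det_eq_det_on: "det x = det_on UNIV (\<lambda>i j. x $ i $ j)"
  by (simp add: det_def det_on_def)

lemma det_ctrans: "det (ctrans x) = cnj (det x)"
proof -
  have "det (ctrans x) = det_on UNIV (\<lambda>i j. cnj (x $ j $ i))"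
    unfolding det_eq_det_on by (rule det_on_cong) simp
  then show ?thesis
    using det_on_transpose[of UNIV "\<lambda>i j. cnj (x $ i $ j)"] by (simp add: det_eq_det_on det_on_cnj)
qed

lemma poly_fun_det: "poly_fun (\<lambda>x. det x)"
  unfolding det_eq_det_on by (intro poly_fun_det_on poly_fun.entry)

lemma poly_fun_cnj_det: "poly_fun (\<lambda>x. cnj (det x))"
  unfolding det_eq_det_on det_on_cnj by (intro poly_fun_det_on poly_fun.cnj_entry)

lemma det_TK: "t \<in> TK \<Longrightarrow> det t = (\<Prod>a\<in>UNIV. t $ a $ a)"
  by (rule det_diagonal) (simp add: TK_def)

lemma extremal_kernel_det:
  assumes s: "bij_betw s {1..d} (UNIV :: 'm::finite set)"
  shows "extremal_kernel s d (\<lambda>a. 1) (\<lambda>x. det x) (\<lambda>x. det x)"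
proof (rule extremal_kernelI[where G = "{()}" and c = 1 and m = "\<lambda>_ x. det x" and w = "\<lambda>_ a. 1"])
  show "extremal_term s d (\<lambda>a. 1) (\<lambda>x. det x) (\<lambda>x. det x) (\<lambda>a. 1)"
    unfolding extremal_term_def
    by (auto simp: det_mul det_TK chr_def dominated_def mult.commute
        intro!: poly_fun_det intro: exI[of _ 1])
  show "det (t ** x) = (\<Prod>a=1..d. (t $ s a $ s a) powi 1) * det x" if "t \<in> TK" for t x
    using prod.reindex_bij_betw[OF s, of "\<lambda>a. t $ a $ a"] that by (simp add: det_mul det_TK)
qed (auto simp: det_mul det_ctrans intro: cfun.span_base)

lemma extremal_kernel_cnj_det:
  assumes s: "bij_betw s {1..d} (UNIV :: 'm::finite set)"
  shows "extremal_kernel s d (\<lambda>a. - 1) (\<lambda>x. cnj (det x)) (\<lambda>x. cnj (det x))"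
proof (rule extremal_kernelI[where G = "{()}" and c = 1 and m = "\<lambda>_ x. cnj (det x)" and w = "\<lambda>_ a. - 1"])
  have chr: "chr (\<lambda>a. - 1) t = cnj (det t)" if "t \<in> TK" for t :: "complex^'m^'m"
    using chr_uminus[OF that, of "\<lambda>a. 1"] by (simp add: det_TK[OF that] chr_def)
  show "extremal_term s d (\<lambda>a. - 1) (\<lambda>x. cnj (det x)) (\<lambda>x. cnj (det x)) (\<lambda>a. - 1)"
    unfolding extremal_term_def
    by (auto simp: det_mul chr dominated_def mult.commute
        intro!: poly_fun_cnj_det intro: exI[of _ 1])
  show "cnj (det (t ** x)) = (\<Prod>a=1..d. (t $ s a $ s a) powi - 1) * cnj (det x)" if "t \<in> TK" for t x
    using prod.reindex_bij_betw[OF s, of "\<lambda>a. (t $ a $ a) powi - 1"] chr[OF that]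
    by (simp add: det_mul chr_def)
qed (auto simp: det_mul det_ctrans intro: cfun.span_base)

section \<open>The functions of the theorem\<close>

definition row_order :: "nat \<Rightarrow> (nat \<Rightarrow> 'm) \<Rightarrow> nat \<Rightarrow> 'm" where
  "row_order n idx a = idx (if a \<le> n then 2 * a - 1 else 2 * (2 * n + 1 - a))"

lemma bij_row_order:
  assumes idx: "bij_betw idx {1..2*n} UNIV"
  shows "bij_betw (row_order n idx) {1..2*n} UNIV"
proof -
  let ?q = "\<lambda>a. if a \<le> n then 2 * a - 1 else 2 * (2 * n + 1 - a)"
  have "bij_betw ?q {1..2*n} {1..2*n}"
    by (rule bij_betw_byWitness[where f' = "\<lambda>b. if even b then 2 * n + 1 - b div 2 else (b + 1) div 2"])
       (auto elim!: evenE oddE)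
  then have "bij_betw (idx \<circ> ?q) {1..2*n} UNIV"
    using idx by (rule bij_betw_trans)
  moreover have "row_order n idx = idx \<circ> ?q"
    by (simp add: fun_eq_iff row_order_def)
  ultimately show ?thesis
    by (simp only:)
qed

lemma row_order_odd: "i \<in> {1..n} \<Longrightarrow> row_order n idx i = idx (2 * i - 1)"
  by (simp add: row_order_def)

lemma row_order_even: "i \<in> {1..n} \<Longrightarrow> row_order n idx (Suc (2 * n) - i) = idx (2 * i)"
  by (auto simp: row_order_def)

section \<open>The factors of the function as minors along the row order\<close>

lemma Delta1p_eq_minor: "Delta1p n idx = minor n (row_order n idx) idx"
  unfolding Delta1p_def detn_eq_det_on minor_def ent_def
  by (intro ext det_on_cong) (simp add: row_order_odd)

lemma Delta1m_eq_minor: "Delta1m n idx Z = cnj (minor n (\<lambda>i. row_order n idx (2 * n + 1 - i)) idx Z)"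
  unfolding Delta1m_def detn_eq_det_on minor_def ent_def det_on_cnj
  by (rule det_on_cong) (simp add: row_order_even)

lemma Delta2p_eq_det:
  assumes "bij_betw idx {1..2*n} UNIV"
  shows "Delta2p n idx Z = det Z"
  unfolding Delta2p_def detn_eq_det_on ent_def det_eq_det_on
  using det_on_reindex[OF assms, of "\<lambda>i j. Z $ i $ j"] by simp

lemma Delta2m_eq_det: "bij_betw idx {1..2*n} UNIV \<Longrightarrow> Delta2m n idx Z = cnj (det Z)"
  using Delta2p_eq_det[of idx n Z, symmetric]
  by (simp add: Delta2m_def Delta2p_def detn_eq_det_on det_on_cnj)

text \<open>Permutations of the odd numbers correspond to those of \<open>{1..k}\<close> through
  \<open>i \<mapsto> 2*i - 1\<close>, and the shift by 1 turns an odd row into the even row below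
  it.\<close>

lemma Fk_eq_det_on: "Fk n idx k Z = det_on {1..k} (\<lambda>i j. Phi n idx Z (2*i - 1) (2*j))"
proof -
  let ?O = "{2*i - 1 | i. 1 \<le> i \<and> i \<le> k}"
  have bij: "bij_betw (\<lambda>i. 2*i - 1) {1..k} ?O"
    by (auto simp: bij_betw_def inj_on_def)
  have "(\<Prod>i=1..k. Phi n idx Z (2*i - 1) (s (2*i - 1) + 1)) = (\<Prod>a\<in>?O. Phi n idx Z a (s a + 1))" for s
    by (rule prod.reindex_bij_betw[OF bij])
  then have "Fk n idx k Z = det_on ?O (\<lambda>a b. Phi n idx Z a (b + 1))"
    unfolding Fk_def det_on_def by simp
  also have "\<dots> = det_on {1..k} (\<lambda>i j. Phi n idx Z (2*i - 1) (2*j - 1 + 1))"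
    by (rule det_on_reindex[OF bij]) simp
  also have "\<dots> = det_on {1..k} (\<lambda>i j. Phi n idx Z (2*i - 1) (2*j))"
    by (rule det_on_cong) simp
  finally show ?thesis .
qed

text \<open>The matrix of the values \<open>Phi\<close> is the product of the odd rows with the
  adjoint of the even rows, both cut to the first \<open>n\<close> columns. Hence the two minors of
  a summand share their columns.\<close>

lemma Fk_expansion:
  assumes k: "k \<le> n"
  shows "Fk n idx k Z = (1 / fact k) * (\<Sum>g\<in>inj_funs {1..k} {1..n}.
    minor k (row_order n idx) (\<lambda>i. idx (g i)) Z * cnj (minor k (\<lambda>i. row_order n idx (2 * n + 1 - i)) (\<lambda>i. idx (g i)) Z))"
proof -
  have P: "det_on {1..k} (\<lambda>i j. Z $ idx (2*i - 1) $ idx (g j)) = minor k (row_order n idx) (\<lambda>i. idx (g i)) Z"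
    for g :: "nat \<Rightarrow> nat"
    unfolding minor_def using k by (intro det_on_cong) (simp add: row_order_odd)
  have Q: "det_on {1..k} (\<lambda>i j. cnj (Z $ idx (2*j) $ idx (g i)))
      = cnj (minor k (\<lambda>i. row_order n idx (2 * n + 1 - i)) (\<lambda>i. idx (g i)) Z)" for g :: "nat \<Rightarrow> nat"
  proof -
    have "det_on {1..k} (\<lambda>i j. cnj (Z $ idx (2*j) $ idx (g i)))
        = det_on {1..k} (\<lambda>i j. cnj (Z $ idx (2*i) $ idx (g j)))"
      by (rule det_on_transpose) simp
    also have "\<dots> = det_on {1..k} (\<lambda>i j. cnj (Z $ row_order n idx (2 * n + 1 - i) $ idx (g j)))"
      using k by (intro det_on_cong) (simp add: row_order_even)
    finally show ?thesis
      by (simp add: minor_def det_on_cnj)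
  qed
  have "fact k * Fk n idx k Z = (\<Sum>g\<in>inj_funs {1..k} {1..n}.
      minor k (row_order n idx) (\<lambda>i. idx (g i)) Z * cnj (minor k (\<lambda>i. row_order n idx (2 * n + 1 - i)) (\<lambda>i. idx (g i)) Z))"
    using Cauchy_Binet[of "{1..k}" "{1..n}" "\<lambda>i c. Z $ idx (2*i - 1) $ idx c" "\<lambda>c j. cnj (Z $ idx (2*j) $ idx c)"]
    unfolding P Q by (simp add: Fk_eq_det_on Phi_def ent_def)
  then show ?thesis
    by (simp add: field_simps)
qed

text \<open>Only diagonal pairs of column sequences with values among the first \<open>n\<close>
  columns occur in \<open>Fk\<close>, so it lies in the span of the pair expansion; the kernel
  function \<open>f\<close> is the product of the two principal minors instead.\<close>

lemma extremal_kernel_Fk: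
  fixes idx :: "nat \<Rightarrow> 'm::finite"
  assumes idx: "bij_betw idx {1..2*n} UNIV" and k: "k \<le> n"
  obtains f where "extremal_kernel (row_order n idx) (2*n)
    (\<lambda>a. (if a \<le> k then 1 else 0) + (if a > 2 * n - k then - 1 else 0)) f (Fk n idx k)"
proof -
  let ?r = "\<lambda>i. row_order n idx (2 * n + 1 - i)"
  let ?G = "inj_funs {1..k} (UNIV :: 'm set)"
  let ?M = "(\<lambda>(g, h) x. minor k (row_order n idx) g x * cnj (minor k ?r h x)) ` (?G \<times> ?G)"
  have pair: "(\<lambda>Z. minor k (row_order n idx) (\<lambda>i. idx (g i)) Z * cnj (minor k ?r (\<lambda>i. idx (g i)) Z)) \<in> ?M"
    if g: "g \<in> inj_funs {1..k} {1..n}" for g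
  proof -
    let ?h = "restrict (\<lambda>i. idx (g i)) {1..k}"
    have "inj_on (idx \<circ> g) {1..k}"
    proof (rule comp_inj_on)
      show "inj_on g {1..k}"
        using g by (simp add: inj_funs_def)
      show "inj_on idx (g ` {1..k})"
        using g by (intro inj_on_subset[OF bij_betw_imp_inj_on[OF idx]]) (force simp: inj_funs_def PiE_iff)
    qed
    then have "?h \<in> ?G"
      by (simp add: inj_funs_def inj_on_restrict_eq o_def)
    moreover have "minor k r (\<lambda>i. idx (g i)) = minor k r ?h" for r :: "nat \<Rightarrow> 'm"
      by (rule minor_cong) auto
    ultimately show ?thesis
      by (intro image_eqI[of _ _ "(?h, ?h)"]) auto
  qed
  have "(\<lambda>Z. \<Sum>g\<in>inj_funs {1..k} {1..n}.
      minor k (row_order n idx) (\<lambda>i. idx (g i)) Z * cnj (minor k ?r (\<lambda>i. idx (g i)) Z)) \<in> cfun.span ?M"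
    using pair by (intro sum_fun_mem_subspace cfun.subspace_span cfun.span_base)
  from cfun.span_scale[OF this, of "1 / fact k"]
  have F: "Fk n idx k \<in> cfun.span ?M"
    unfolding Fk_expansion[OF k, abs_def] .
  have "k \<le> 2 * n"
    using k by simp
  from that[OF extremal_kernel_minor_pair[OF bij_row_order[OF idx] this F]] show thesis .
qed

text \<open>The summands with \<open>k \<ge> a\<close> telescope; monotonicity of \<open>N\<close>
  ensures that \<open>nat\<close> truncates nothing.\<close>

lemma telescope:
  fixes N :: "nat \<Rightarrow> int"
  assumes "\<forall>i\<in>{1..<n}. N i \<ge> N (i+1)" "1 \<le> a" "a \<le> n"
  shows "(\<Sum>k=1..n-1. int (nat (N k - N (k+1))) * (if a \<le> k then 1 else 0)) = N a - N n"
proof -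
  have "(\<Sum>k=1..<m. int (nat (N k - N (k+1))) * (if a \<le> k then 1 else 0)) = N a - N m"
    if "a \<le> m" "m \<le> n" for m
    using that
  proof (induction m rule: dec_induct)
    case base
    show ?case
      by (auto intro!: sum.neutral)
  next
    case (step m)
    then show ?case
      using assms by (simp add: sum.atLeastLessThan_Suc)
  qed
  moreover have "{1..n-1} = {1..<n}"
    using assms by auto
  ultimately show ?thesis
    using assms(3) by simp
qed

text \<open>The exponents balance: at places \<open>a \<le> n\<close> the factors after the
  telescoping product contribute \<open>N n - \<bar>l + L\<bar>\<close>, then 0 or
  \<open>-2*(l + L)\<close> according to the sign of \<open>l + L\<close>, then
  \<open>l + 2*L\<close>. Either sign leaves \<open>N n + L\<close>; at the later places the same
  count gives \<open>- N n + L\<close>.\<close>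

lemma extremal_kernel_FNlL:
  fixes idx :: "nat \<Rightarrow> 'm::finite" and l L :: int
  assumes n: "n \<ge> 1" and idx: "bij_betw idx {1..2*n} UNIV"
    and N: "\<forall>i\<in>{1..<n}. N i \<ge> N (i+1)" and Nn: "N n \<ge> \<bar>l + L\<bar>"
  obtains f where "extremal_kernel (row_order n idx) (2*n) (LambdaW n N L) f (FNlL n idx N l L)"
proof -
  let ?s = "row_order n idx"
  define A where "A k a = (if a \<le> k then 1 else 0 :: int)" for k a :: nat
  define B where "B k a = (if a > 2 * n - k then - 1 else 0 :: int)" for k a :: nat
  note s = bij_row_order[OF idx]
  \<comment> \<open>The guard sits inside the existential so that one choice function serves all
    \<open>k\<close>.\<close>
  have "\<exists>f. k \<le> n \<longrightarrow> extremal_kernel ?s (2*n) (\<lambda>a. A k a + B k a) f (Fk n idx k)" for k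
  proof (cases "k \<le> n")
    case True
    show ?thesis
      unfolding A_def B_def by (rule extremal_kernel_Fk[OF idx True]) blast
  qed blast
  then obtain f where f: "\<And>k. k \<le> n \<Longrightarrow> extremal_kernel ?s (2*n) (\<lambda>a. A k a + B k a) (f k) (Fk n idx k)"
    using choice[of "\<lambda>k f. k \<le> n \<longrightarrow> extremal_kernel ?s (2*n) (\<lambda>a. A k a + B k a) f (Fk n idx k)"]
    by blast
  have inj: "inj_on idx {1..n}"
    by (rule inj_on_initial[OF idx]) simp
  have le: "n \<le> 2 * n"
    by simp
  define D1 where "D1 Z = (if l + L \<ge> 0 then Delta1m n idx Z ^ nat (2*(l+L)) else Delta1p n idx Z ^ nat (-2*(l+L)))"
    for Z
  define D2 where "D2 Z = (if l + 2*L \<ge> 0 then Delta2p n idx Z ^ nat (l+2*L) else Delta2m n idx Z ^ nat (-(l+2*L)))"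
    for Z
  define C1 where "C1 a = (if l + L \<ge> 0 then int (nat (2*(l+L))) * B n a else int (nat (-2*(l+L))) * A n a)" for a
  obtain d1 where d1: "extremal_kernel ?s (2*n) C1 d1 D1"
  proof (cases "l + L \<ge> 0")
    case True
    then have "D1 = (\<lambda>Z. cnj (minor n (\<lambda>i. ?s (2 * n + 1 - i)) idx Z) ^ nat (2*(l+L)))"
      "C1 = (\<lambda>a. int (nat (2*(l+L))) * B n a)"
      by (simp_all add: D1_def C1_def Delta1m_eq_minor fun_eq_iff)
    then show thesis
      using that extremal_kernel_power[OF s extremal_kernel_cnj_minor[OF s le inj]] unfolding B_def by blast
  next
    case False
    then have "D1 = (\<lambda>Z. minor n ?s idx Z ^ nat (-2*(l+L)))"
      "C1 = (\<lambda>a. int (nat (-2*(l+L))) * A n a)"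
      by (simp_all add: D1_def C1_def Delta1p_eq_minor fun_eq_iff)
    then show thesis
      using that extremal_kernel_power[OF s extremal_kernel_minor[OF s le inj]] unfolding A_def by blast
  qed
  obtain d2 where d2: "extremal_kernel ?s (2*n) (\<lambda>a. l + 2*L) d2 D2"
  proof (cases "l + 2*L \<ge> 0")
    case True
    then show thesis
      using that extremal_kernel_power[OF s extremal_kernel_det[OF s], of "nat (l + 2*L)"]
      by (simp add: D2_def[abs_def] Delta2p_eq_det[OF idx])
  next
    case False
    then show thesis
      using that extremal_kernel_power[OF s extremal_kernel_cnj_det[OF s], of "nat (- (l + 2*L))"]
      by (simp add: D2_def[abs_def] Delta2m_eq_det[OF idx] add.commute)
  qed
  let ?C = "\<lambda>a. (\<Sum>k=1..n-1. int (nat (N k - N (k+1))) * (A k a + B k a))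
    + int (nat (N n - \<bar>l + L\<bar>)) * (A n a + B n a) + C1 a + (l + 2*L)"
  have "extremal_kernel ?s (2*n) (\<lambda>a. \<Sum>k=1..n-1. int (nat (N k - N (k+1))) * (A k a + B k a))
      (\<lambda>Z. \<Prod>k=1..n-1. f k Z ^ nat (N k - N (k+1))) (\<lambda>Z. \<Prod>k=1..n-1. Fk n idx k Z ^ nat (N k - N (k+1)))"
    by (intro extremal_kernel_prod[OF s] extremal_kernel_power[OF s] f) auto
  from extremal_kernel_mult[OF s extremal_kernel_mult[OF s extremal_kernel_mult[OF s this
        extremal_kernel_power[OF s f[OF order_refl], of "nat (N n - \<bar>l + L\<bar>)"]] d1] d2]
  obtain h where "extremal_kernel ?s (2*n) ?C h (FNlL n idx N l L)"
    by (simp add: FNlL_def[abs_def] D1_def D2_def)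
  moreover have "?C a = LambdaW n N L a" if a: "a \<in> {1..2*n}" for a
  proof (cases "a \<le> n")
    case True
    have AB: "A k a = (if a \<le> k then 1 else 0)" "B k a = 0" if "k \<le> n" for k
      using True that by (simp_all add: A_def B_def)
    have "(\<Sum>k=1..n-1. int (nat (N k - N (k+1))) * (A k a + B k a))
        = (\<Sum>k=1..n-1. int (nat (N k - N (k+1))) * (if a \<le> k then 1 else 0))"
      using AB by (intro sum.cong) auto
    also have "\<dots> = N a - N n"
      using telescope[OF N _ True] a by simp
    finally show ?thesis
      using True Nn AB[of n] by (simp add: C1_def LambdaW_def)
  next
    case False
    define b where "b = 2 * n + 1 - a"
    have b: "1 \<le> b" "b \<le> n"
      using a False by (auto simp: b_def)
    have AB: "A k a = 0" "B k a = - (if b \<le> k then 1 else 0)" if "k \<le> n" for k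
      using False that a by (auto simp: A_def B_def b_def)
    have "(\<Sum>k=1..n-1. int (nat (N k - N (k+1))) * (A k a + B k a))
        = - (\<Sum>k=1..n-1. int (nat (N k - N (k+1))) * (if b \<le> k then 1 else 0))"
      unfolding sum_negf[symmetric] using AB by (intro sum.cong) auto
    also have "\<dots> = N n - N b"
      using telescope[OF N b] by simp
    finally have "(\<Sum>k=1..n-1. int (nat (N k - N (k+1))) * (A k a + B k a)) = N n - N b" .
    moreover have "LambdaW n N L a = - N b + L"
      using False by (simp add: LambdaW_def b_def)
    ultimately show ?thesis
      using Nn AB[of n] b by (simp add: C1_def)
  qed
  ultimately show thesis
    using that extremal_kernel_cong by blast
qed

text \<open>Place \<open>i\<close> of the row order is row \<open>2*i - 1\<close> with exponent
  \<open>N i + L\<close>, and place \<open>2*n + 1 - i\<close> is row \<open>2*i\<close> with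
  exponent \<open>- N i + L\<close>. So the second half is matched with the first in
  reverse.\<close>

lemma left_character:
  assumes idx: "bij_betw idx {1..2*n} (UNIV :: 'm::finite set)" and t: "t \<in> TK"
  shows "(\<Prod>a=1..2*n. (t $ row_order n idx a $ row_order n idx a) powi LambdaW n N L a)
    = (\<Prod>i=1..n. chi (N i + L) (ent idx t (2*i-1) (2*i-1)) * chi (- N i + L) (ent idx t (2*i) (2*i)))"
proof -
  let ?h = "\<lambda>a. (t $ row_order n idx a $ row_order n idx a) powi LambdaW n N L a"
  have "{1..2*n} = {1..n} \<union> {n+1..2*n}"
    by auto
  then have "(\<Prod>a=1..2*n. ?h a) = (\<Prod>a=1..n. ?h a) * (\<Prod>a=n+1..2*n. ?h a)"
    by (simp add: prod.union_disjoint)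
  also have "(\<Prod>a=n+1..2*n. ?h a) = (\<Prod>i=1..n. ?h (2 * n + 1 - i))"
    by (rule prod.reindex_bij_witness[of _ "\<lambda>i. 2 * n + 1 - i" "\<lambda>a. 2 * n + 1 - a"]) auto
  also have "(\<Prod>a=1..n. ?h a) * (\<Prod>i=1..n. ?h (2 * n + 1 - i))
      = (\<Prod>i=1..n. chi (N i + L) (ent idx t (2*i-1) (2*i-1)) * chi (- N i + L) (ent idx t (2*i) (2*i)))"
    unfolding prod.distrib[symmetric]
    by (intro prod.cong refl arg_cong2[where f = "(*)"])
       (auto simp: row_order_def LambdaW_def ent_def chi_unit TK_norm[OF t])
  finally show ?thesis .
qed

section \<open>Right translation by block diagonal matrices\<close>

lemma sum_two_blocks:
  fixes f :: "nat \<Rightarrow> 'a::comm_monoid_add"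
  shows "(\<Sum>c=1..2*n. f c) = (\<Sum>c=1..n. f c) + (\<Sum>c=1..n. f (c + n))"
proof -
  have "{1..2*n} = {1..n} \<union> {n+1..2*n}"
    by auto
  then have "(\<Sum>c=1..2*n. f c) = (\<Sum>c=1..n. f c) + (\<Sum>c=n+1..2*n. f c)"
    by (simp add: sum.union_disjoint)
  also have "(\<Sum>c=n+1..2*n. f c) = (\<Sum>c=1..n. f (c + n))"
    by (rule sum.reindex_bij_witness[of _ "\<lambda>c. c + n" "\<lambda>c. c - n"]) auto
  finally show ?thesis .
qed

definition blocks :: "nat \<Rightarrow> (nat \<Rightarrow> nat \<Rightarrow> complex) \<Rightarrow> (nat \<Rightarrow> nat \<Rightarrow> complex) \<Rightarrow> nat \<Rightarrow> nat \<Rightarrow> complex" where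
  "blocks n k1 k2 a b = (if a \<le> n \<and> b \<le> n then k1 a b
     else if n < a \<and> n < b then k2 (a - n) (b - n) else 0)"

lemma blockdiag_nth:
  assumes idx: "bij_betw idx {1..2*n} (UNIV :: 'm::finite set)" and "a \<in> {1..2*n}" "b \<in> {1..2*n}"
  shows "blockdiag n idx k1 k2 $ idx a $ idx b = blocks n k1 k2 a b"
  using bij_betw_inv_into_left[OF idx] assms(2,3) by (simp add: blockdiag_def blocks_def Let_def)

lemma Unit_n_det_norm:
  assumes "M \<in> Unit_n n"
  shows "cmod (detn n M) = 1"
proof -
  have "det_on {1..n} M * det_on {1..n} (\<lambda>i j. cnj (M j i))
      = det_on {1..n} (\<lambda>i j. \<Sum>c=1..n. M i c * cnj (M j c))"
    by (rule det_on_mult[symmetric]) simp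
  also have "\<dots> = det_on {1..n} (\<lambda>i j. if i = j then 1 else 0)"
    using assms by (intro det_on_cong) (simp add: Unit_n_def)
  also have "\<dots> = 1"
    by (simp add: det_on_identity)
  also have "det_on {1..n} (\<lambda>i j. cnj (M j i)) = cnj (det_on {1..n} M)"
    unfolding det_on_cnj by (rule det_on_transpose) simp
  finally have "(cmod (det_on {1..n} M))\<^sup>2 = 1"
    by (metis complex_norm_square of_real_eq_1_iff)
  then show ?thesis
    by (simp add: detn_eq_det_on power2_eq_1_iff) (smt (verit) norm_ge_zero)
qed

text \<open>The block matrix factors as diag(k1, 1) times diag(1, k2), and each factor is the
  identity outside one block.\<close>

lemma det_blocks: "det_on {1..2*n} (blocks n k1 k2) = detn n k1 * detn n k2"
proof -
  let ?I = "\<lambda>i j. if i = j then 1 else 0 :: complex"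
  let ?P = "blocks n k1 ?I" and ?Q = "blocks n ?I k2"
  have "(\<Sum>c=1..2*n. ?P a c * ?Q c b) = blocks n k1 k2 a b" if "a \<in> {1..2*n}" "b \<in> {1..2*n}" for a b
  proof (cases "a \<le> n")
    case True
    have "(\<Sum>c=1..n. ?P a c * ?Q c b) = (\<Sum>c=1..n. if c = b then k1 a c else 0)"
      using True by (intro sum.cong) (auto simp: blocks_def)
    moreover have "(\<Sum>c=1..n. ?P a (c + n) * ?Q (c + n) b) = 0"
      using True by (intro sum.neutral) (auto simp: blocks_def)
    ultimately show ?thesis
      unfolding sum_two_blocks using True that by (simp add: blocks_def)
  next
    case False
    have "(\<Sum>c=1..n. ?P a c * ?Q c b) = 0"
      using False by (intro sum.neutral) (auto simp: blocks_def)
    moreover have "(\<Sum>c=1..n. ?P a (c + n) * ?Q (c + n) b)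
        = (\<Sum>c=1..n. if c = a - n then blocks n k1 k2 a b else 0)"
      using False by (intro sum.cong) (auto simp: blocks_def)
    ultimately show ?thesis
      unfolding sum_two_blocks using False that by auto
  qed
  then have "det_on {1..2*n} (blocks n k1 k2) = det_on {1..2*n} (\<lambda>a b. \<Sum>c=1..2*n. ?P a c * ?Q c b)"
    by (intro det_on_cong) simp
  also have "\<dots> = det_on {1..2*n} ?P * det_on {1..2*n} ?Q"
    by (rule det_on_mult) simp
  also have "det_on {1..2*n} ?P = det_on {1..n} ?P"
    by (rule det_on_restrict) (auto simp: blocks_def)
  also have "\<dots> = detn n k1"
    unfolding detn_eq_det_on by (rule det_on_cong) (simp add: blocks_def)
  also have "det_on {1..2*n} ?Q = det_on {n+1..2*n} ?Q"
    by (rule det_on_restrict) (auto simp: blocks_def)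
  also have "\<dots> = det_on {1..n} (\<lambda>i j. ?Q (i + n) (j + n))"
    by (rule det_on_reindex)
       (auto intro!: bij_betw_byWitness[where f' = "\<lambda>i. i - n"])
  also have "\<dots> = detn n k2"
    unfolding detn_eq_det_on by (rule det_on_cong) (simp add: blocks_def)
  finally show ?thesis .
qed

locale block_translation =
  fixes n :: nat and idx :: "nat \<Rightarrow> 'm::finite" and k1 k2 :: "nat \<Rightarrow> nat \<Rightarrow> complex"
  assumes idx: "bij_betw idx {1..2*n} UNIV"
    and k1: "k1 \<in> Unit_n n" and k2: "k2 \<in> Unit_n n"
begin

abbreviation B :: "complex^'m^'m" where
  "B \<equiv> blockdiag n idx k1 k2"

lemma B_UK: "B \<in> UK"
proof -
  have "(B ** ctrans B) $ idx a $ idx b = mat 1 $ idx a $ idx b"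
    if ab: "a \<in> {1..2*n}" "b \<in> {1..2*n}" for a b
  proof -
    have "(B ** ctrans B) $ idx a $ idx b = (\<Sum>c=1..2*n. B $ idx a $ idx c * cnj (B $ idx b $ idx c))"
      unfolding matrix_mult_nth ctrans_nth by (rule sum.reindex_bij_betw[OF idx, symmetric])
    also have "\<dots> = (\<Sum>c=1..2*n. blocks n k1 k2 a c * cnj (blocks n k1 k2 b c))"
      using ab by (intro sum.cong) (simp_all add: blockdiag_nth[OF idx])
    also have "\<dots> = (if a = b then 1 else 0)"
    proof -
      have "(\<Sum>c=1..n. k1 a c * cnj (k1 b c)) = (if a = b then 1 else 0)" if "a \<le> n" "b \<le> n"
        using k1 ab that by (simp add: Unit_n_def)
      moreover have "(\<Sum>c=1..n. k2 (a - n) c * cnj (k2 (b - n) c)) = (if a = b then 1 else 0)"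
        if "n < a" "n < b"
      proof -
        have "a - n \<in> {1..n}" "b - n \<in> {1..n}" "a - n = b - n \<longleftrightarrow> a = b"
          using ab that by auto
        then show ?thesis
          using k2 by (simp add: Unit_n_def)
      qed
      ultimately show ?thesis
        unfolding sum_two_blocks by (cases "a \<le> n"; cases "b \<le> n") (auto simp: blocks_def)
    qed
    also have "\<dots> = mat 1 $ idx a $ idx b"
      using bij_betw_imp_inj_on[OF idx] ab by (simp add: mat_def inj_on_eq_iff)
    finally show ?thesis .
  qed
  moreover have "\<exists>a\<in>{1..2*n}. i = idx a" for i
    using bij_betw_imp_surj_on[OF idx] by blast
  ultimately have "(B ** ctrans B) $ i $ j = mat 1 $ i $ j" for i j
    by metis
  then show ?thesis
    by (simp add: UK_def vec_eq_iff)
qed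

text \<open>The first \<open>n\<close> columns of the block matrix vanish below row
  \<open>n\<close>, so only \<open>k1\<close> and the first \<open>n\<close> columns of
  \<open>k\<close> enter.\<close>

lemma ent_translate:
  assumes c: "c \<in> {1..n}"
  shows "ent idx (k ** B) a c = (\<Sum>b=1..n. ent idx k a b * k1 b c)"
proof -
  have "ent idx (k ** B) a c = (\<Sum>b=1..2*n. k $ idx a $ idx b * B $ idx b $ idx c)"
    unfolding ent_def matrix_mult_nth by (rule sum.reindex_bij_betw[OF idx, symmetric])
  also have "\<dots> = (\<Sum>b=1..2*n. k $ idx a $ idx b * blocks n k1 k2 b c)"
    using c by (intro sum.cong) (simp_all add: blockdiag_nth[OF idx])
  also have "\<dots> = (\<Sum>b=1..n. ent idx k a b * k1 b c)"
    unfolding sum_two_blocks using c by (simp add: blocks_def ent_def)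
  finally show ?thesis .
qed

text \<open>With the sum over \<open>c\<close> moved inside, it becomes the Hermitian product of two
  rows of \<open>k1\<close>, which is 1 or 0 by unitarity.\<close>

lemma Phi_translate: "Phi n idx (k ** B) i j = Phi n idx k i j"
proof -
  have "Phi n idx (k ** B) i j
      = (\<Sum>c=1..n. \<Sum>b=1..n. \<Sum>b'=1..n. (ent idx k i b * cnj (ent idx k j b')) * (k1 b c * cnj (k1 b' c)))"
    unfolding Phi_def by (intro sum.cong) (simp_all add: ent_translate sum_product mult_ac)
  also have "\<dots> = (\<Sum>b=1..n. \<Sum>c=1..n. \<Sum>b'=1..n. (ent idx k i b * cnj (ent idx k j b')) * (k1 b c * cnj (k1 b' c)))"
    by (rule sum.swap)
  also have "\<dots> = (\<Sum>b=1..n. \<Sum>b'=1..n. \<Sum>c=1..n. (ent idx k i b * cnj (ent idx k j b')) * (k1 b c * cnj (k1 b' c)))"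
    by (intro sum.cong refl sum.swap)
  also have "\<dots> = (\<Sum>b=1..n. \<Sum>b'=1..n. (ent idx k i b * cnj (ent idx k j b')) * (if b = b' then 1 else 0))"
    unfolding sum_distrib_left[symmetric] using k1 by (intro sum.cong refl) (simp add: Unit_n_def)
  also have "\<dots> = Phi n idx k i j"
    by (simp add: Phi_def if_distrib cong: if_cong)
  finally show ?thesis .
qed

lemma Delta1p_translate: "Delta1p n idx (k ** B) = Delta1p n idx k * detn n k1"
proof -
  have "Delta1p n idx (k ** B) = det_on {1..n} (\<lambda>i c. \<Sum>b=1..n. ent idx k (2*i - 1) b * k1 b c)"
    unfolding Delta1p_def detn_eq_det_on by (rule det_on_cong) (simp add: ent_translate)
  then show ?thesis
    by (simp add: det_on_mult Delta1p_def detn_eq_det_on)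
qed

lemma Delta1m_translate: "Delta1m n idx (k ** B) = Delta1m n idx k * cnj (detn n k1)"
proof -
  have "Delta1m n idx (k ** B) = det_on {1..n} (\<lambda>i c. \<Sum>b=1..n. cnj (ent idx k (2*i) b) * cnj (k1 b c))"
    unfolding Delta1m_def detn_eq_det_on by (rule det_on_cong) (simp add: ent_translate)
  then show ?thesis
    by (simp add: det_on_mult Delta1m_def detn_eq_det_on det_on_cnj)
qed

lemma det_translate: "det (k ** B) = det k * (detn n k1 * detn n k2)"
proof -
  have "det B = det_on {1..2*n} (\<lambda>a b. B $ idx a $ idx b)"
    unfolding det_eq_det_on by (rule det_on_reindex[OF idx]) simp
  also have "\<dots> = det_on {1..2*n} (blocks n k1 k2)"
    by (rule det_on_cong) (simp add: blockdiag_nth[OF idx])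
  also have "\<dots> = detn n k1 * detn n k2"
    by (rule det_blocks)
  finally show ?thesis
    by (simp add: det_mul)
qed

lemma Fk_translate: "Fk n idx i (k ** B) = Fk n idx i k"
  by (simp add: Fk_eq_det_on Phi_translate)

text \<open>The \<open>Fk\<close> are invariant, the \<open>Delta1\<close> factor contributes the
  power \<open>-2*(l + L)\<close> of det k1, and the full determinant the power
  \<open>l + 2*L\<close> of both block determinants. The exponents of det k1 add up to
  \<open>-l\<close>.\<close>

lemma FNlL_translate:
  "FNlL n idx N l L (k ** B) = chi (-l) (detn n k1) * chi (l + 2*L) (detn n k2) * FNlL n idx N l L k"
proof -
  let ?z1 = "detn n k1" and ?z2 = "detn n k2"
  have norm: "cmod ?z1 = 1" "cmod ?z2 = 1"
    using Unit_n_det_norm k1 k2 by auto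
  \<comment> \<open>On the unit circle conjugation is inversion, so the two branches of each case
    distinction become a single integer power.\<close>
  have pow: "m \<ge> 0 \<Longrightarrow> z ^ nat m = z powi m" "m \<le> 0 \<Longrightarrow> cnj z ^ nat (- m) = z powi m"
    if "cmod z = 1" for z m
  proof -
    have "cnj z = inverse z"
      using inverse_unique[of z "cnj z"] that by (simp add: complex_norm_square[symmetric])
    then show "m \<ge> 0 \<Longrightarrow> z ^ nat m = z powi m" "m \<le> 0 \<Longrightarrow> cnj z ^ nat (- m) = z powi m"
      by (auto simp: power_int_def power_inverse)
  qed
  have 1: "(if l + L \<ge> 0 then Delta1m n idx (k ** B) ^ nat (2*(l+L)) else Delta1p n idx (k ** B) ^ nat (-2*(l+L)))
      = (if l + L \<ge> 0 then Delta1m n idx k ^ nat (2*(l+L)) else Delta1p n idx k ^ nat (-2*(l+L)))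
        * ?z1 powi (-2*(l+L))"
    using pow[OF norm(1), of "-2*(l+L)"]
    by (auto simp: Delta1m_translate Delta1p_translate power_mult_distrib algebra_simps)
  have 2: "(if l + 2*L \<ge> 0 then Delta2p n idx (k ** B) ^ nat (l+2*L) else Delta2m n idx (k ** B) ^ nat (-(l+2*L)))
      = (if l + 2*L \<ge> 0 then Delta2p n idx k ^ nat (l+2*L) else Delta2m n idx k ^ nat (-(l+2*L)))
        * (?z1 * ?z2) powi (l+2*L)"
  proof (cases "l + 2*L \<ge> 0")
    case True
    then show ?thesis
      using pow(1)[of "?z1 * ?z2" "l+2*L"] norm
      by (simp add: Delta2p_eq_det[OF idx] det_translate power_mult_distrib norm_mult)
  next
    case False
    then show ?thesis
      using pow(2)[of "?z1 * ?z2" "l+2*L"] norm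
      by (simp add: Delta2m_eq_det[OF idx] det_translate power_mult_distrib norm_mult)
  qed
  have "?z1 \<noteq> 0"
    using norm by auto
  then have "?z1 powi (-2*(l+L)) * ?z1 powi (l+2*L) = ?z1 powi (-l)"
    by (simp add: power_int_add[symmetric])
  then have 3: "?z1 powi (-2*(l+L)) * (?z1 * ?z2) powi (l+2*L) = chi (-l) ?z1 * chi (l+2*L) ?z2"
    using norm by (simp add: chi_unit power_int_mult_distrib mult.assoc[symmetric])
  have 4: "p * (x * u) * (y * v) = u * v * (p * x * y)" for p x y u v :: complex
    by simp
  show ?thesis
    unfolding FNlL_def 1 2 Fk_translate 4 3 ..
qed

end

theorem theorem3p10:
  fixes n :: nat and idx :: "nat \<Rightarrow> 'm::finite" and N :: "nat \<Rightarrow> int" and l L :: int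
  assumes "n \<ge> 1"
    and "bij_betw idx {1..2*n} (UNIV :: 'm set)"
    and "\<forall>i\<in>{1..<n}. N i \<ge> N (i+1)"
    and "N n \<ge> \<bar>l + L\<bar>"
  shows "iota (FNlL n idx N l L) \<in> piK n idx N L
    \<and> (\<exists>W. constituent_hw n idx N L (LambdaW n N L) W \<and> iota (FNlL n idx N l L) \<in> W)
    \<and> (\<forall>k\<in>UK. \<forall>k1\<in>Unit_n n. \<forall>k2\<in>Unit_n n.
          iota (FNlL n idx N l L) (k ** blockdiag n idx k1 k2)
          = chi (-l) (detn n k1) * chi (l + 2*L) (detn n k2) * iota (FNlL n idx N l L) k)"
proof -
  obtain f where "extremal_kernel (row_order n idx) (2*n) (LambdaW n N L) f (FNlL n idx N l L)"
    using extremal_kernel_FNlL[OF assms] by blast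
  then obtain W where W: "constituent_hw n idx N L (LambdaW n N L) W" "iota (FNlL n idx N l L) \<in> W"
    using extremal_kernel_constituent[OF bij_row_order[OF assms(2)] assms(2) _ left_character[OF assms(2)]]
    by blast
  moreover have "iota (FNlL n idx N l L) \<in> piK n idx N L"
    using W by (auto simp: constituent_hw_def)
  moreover have "iota (FNlL n idx N l L) (k ** blockdiag n idx k1 k2)
      = chi (-l) (detn n k1) * chi (l + 2*L) (detn n k2) * iota (FNlL n idx N l L) k"
    if k: "k \<in> UK" and "k1 \<in> Unit_n n" "k2 \<in> Unit_n n" for k k1 k2
  proof -
    interpret block_translation n idx k1 k2
      using assms(2) that by unfold_locales
    show ?thesis
      using UK_mult[OF k B_UK] k by (simp only: iota_UK FNlL_translate)
  qed
  ultimately show ?thesis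
    by blast
qed

end
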